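(* There is an absolute constant $c>0$ such that for any $\epsilon>0$ and $\delta>0$, if $\gamma\leq c\,\frac{\epsilon^2}{\log(n/\epsilon)}$, then Algorithm 3 (described in the context), run with $T=\Theta\big(\frac{\gamma m\log(n/\delta)}{\epsilon^2}\big)$ samples for a suitable constant in the $\Theta$, solves the gap version of the mixed covering-packing problem with probability at least $1-\delta$, i.e. it outputs YES on every YES instance and NO on every NO instance with probability at least $1-\delta$, using $\Theta\big(\frac{\gamma m\log(n/\delta)}{\epsilon^2}\big)$ oracle calls.
   Context: Mixed covering-packing integer program: there are $m$ requests $j$, $n$ indices $i$, and a finite set of options $k$; the variables are $x_{jk}\in\{0,1\}$ with $\sum_k x_{jk}\leq 1$ for each $j$ (choosing no option is the null option $\bot$); the constraints are $\sum_{j,k}a_{ijk}x_{jk}\leq c_i$ and $\sum_{j,k} w_{ijk}x_{jk}\geq d_i$ for each $i$, where $a_{ijk},w_{ijk}\geq 0$ and $c_i,d_i>0$. $\gamma=\max(\{a_{ijk}/c_i\}_{i,j,k}\cup\{w_{ijk}/d_i\}_{i,j,k})$. Gap version: YES instances are those with a feasible solution; NO instances are those with no feasible solution even if every $c_i$ is multiplied by $1+3\epsilon(1+\epsilon)$ and every $d_i$ by $1-3\epsilon(1+\epsilon)$. An oracle call is, given a request $j$ and a vector $v$, computing an option maximizing $v\cdot x_j$ over $x_j\in\{0,1\}^{K}$ with $\sum_k x_{jk}\le 1$. Algorithm 3: for $s=1,\dots,T$, sample a request $j$ uniformly at random (with replacement) from the $m$ requests. Let $S^x_{i,s}$, $S^y_{i,s}$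 be $\sum_{t\leq s}X_{i,t}$, $\sum_{t\le s}Y_{i,t}$ where $X_{i,t}=a_{ijk^*}$, $Y_{i,t}=w_{ijk^*}$ for the request and option chosen at step $t$, and let $\phi_{i,s}=\frac{1}{c_i}\cdot\frac{(1+\epsilon)^{S^x_{i,s}/(\gamma c_i)}(1+\frac{\epsilon}{m\gamma})^{T-s-1}}{(1+\epsilon)^{(1+\epsilon)T/(m\gamma)}}$ and $\psi_{i,s}=\frac{1}{d_i}\cdot\frac{(1-\epsilon)^{S^y_{i,s}/(\gamma d_i)}(1-\frac{\epsilon}{m\gamma})^{T-s-1}}{(1-\epsilon)^{(1-\epsilon)T/(m\gamma)}}$. At step $s$ choose $k^*=\arg\min_{k\in\mathcal{K}\cup\{\bot\}}\{\sum_i a_{ijk}\phi_{i,s-1}-\sum_i w_{ijk}\psi_{i,s-1}\}$. After $T$ steps, output YES if for all $i$, $\sum_{t=1}^T X_{i,t}<\frac{Tc_i}{m}(1+\epsilon)$ and $\sum_{t=1}^T Y_{i,t}>\frac{Td_i}{m}(1-\epsilon)$; otherwise output NO.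
   Formalization: Proved for 0<ε<1 (for ε≥1 the powers of 1−ε in ψ are undefined), and T uses log(max(2,n/δ)), rounded up, in place of log(n/δ); for n=1 and δ near 1 the literal formula gives T=1, and the algorithm can then always fail on a YES instance. *)

theory Defs
  imports "HOL-Probability.Probability"
begin

text \<open>Requests, indices and options are \<open>{..<reqs P}\<close>, \<open>{..<idxs P}\<close> and \<open>{..<opts P}\<close>;
  \<open>pack P i j k\<close> is \<open>a\<^sub>i\<^sub>j\<^sub>k\<close> and \<open>cov P i j k\<close> is \<open>w\<^sub>i\<^sub>j\<^sub>k\<close>.\<close>

record mcp =
  reqs :: nat
  idxs :: nat
  opts :: nat
  pack :: "nat \<Rightarrow> nat \<Rightarrow> nat \<Rightarrow> real"
  cov  :: "nat \<Rightarrow> nat \<Rightarrow> nat \<Rightarrow> real"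
  cap  :: "nat \<Rightarrow> real"
  dem  :: "nat \<Rightarrow> real"

definition wf_mcp :: "mcp \<Rightarrow> bool" where
  "wf_mcp P \<longleftrightarrow> 0 < reqs P \<and> 0 < idxs P \<and> 0 < opts P \<and>
     (\<forall>i<idxs P. 0 < cap P i \<and> 0 < dem P i \<and>
        (\<forall>j<reqs P. \<forall>k<opts P. 0 \<le> pack P i j k \<and> 0 \<le> cov P i j k))"

definition choice_vectors :: "mcp \<Rightarrow> (nat \<Rightarrow> real) set" where
  "choice_vectors P = {y. (\<forall>k<opts P. y k \<in> {0, 1}) \<and> (\<Sum>k<opts P. y k) \<le> 1}"

definition feasible :: "mcp \<Rightarrow> (nat \<Rightarrow> nat \<Rightarrow> real) \<Rightarrow> bool" where
  "feasible P x \<longleftrightarrow> (\<forall>j<reqs P. x j \<in> choice_vectors P) \<and>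
     (\<forall>i<idxs P. (\<Sum>j<reqs P. \<Sum>k<opts P. pack P i j k * x j k) \<le> cap P i \<and>
                 (\<Sum>j<reqs P. \<Sum>k<opts P. cov P i j k * x j k) \<ge> dem P i)"

definition relaxed :: "real \<Rightarrow> mcp \<Rightarrow> mcp" where
  "relaxed \<epsilon> P = P\<lparr>cap := \<lambda>i. cap P i * (1 + 3 * \<epsilon> * (1 + \<epsilon>)),
                   dem := \<lambda>i. dem P i * (1 - 3 * \<epsilon> * (1 + \<epsilon>))\<rparr>"

definition yes_instance :: "mcp \<Rightarrow> bool" where
  "yes_instance P \<longleftrightarrow> (\<exists>x. feasible P x)"

definition no_instance :: "real \<Rightarrow> mcp \<Rightarrow> bool" where
  "no_instance \<epsilon> P \<longleftrightarrow> \<not> (\<exists>x. feasible (relaxed \<epsilon> P) x)"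

definition gam :: "mcp \<Rightarrow> real" where
  "gam P = Max ({pack P i j k / cap P i | i j k. i < idxs P \<and> j < reqs P \<and> k < opts P} \<union>
                {cov P i j k / dem P i | i j k. i < idxs P \<and> j < reqs P \<and> k < opts P})"

text \<open>The null option is \<open>None\<close>. An oracle may break ties arbitrarily.\<close>

definition choice_vec :: "nat option \<Rightarrow> nat \<Rightarrow> real" where
  "choice_vec k\<^sub>0 k = (if k\<^sub>0 = Some k then 1 else 0)"

definition is_oracle :: "mcp \<Rightarrow> (nat \<Rightarrow> (nat \<Rightarrow> real) \<Rightarrow> nat option) \<Rightarrow> bool" where
  "is_oracle P orc \<longleftrightarrow> (\<forall>j<reqs P. \<forall>v.
     orc j v \<in> insert None (Some ` {..<opts P}) \<and>
     (\<forall>y\<in>choice_vectors P.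
        (\<Sum>k<opts P. v k * y k) \<le> (\<Sum>k<opts P. v k * choice_vec (orc j v) k)))"

definition phi :: "mcp \<Rightarrow> real \<Rightarrow> nat \<Rightarrow> (nat \<Rightarrow> real) \<Rightarrow> nat \<Rightarrow> nat \<Rightarrow> real" where
  "phi P \<epsilon> T Sx s i = 1 / cap P i *
     ((1 + \<epsilon>) powr (Sx i / (gam P * cap P i)) *
      (1 + \<epsilon> / (real (reqs P) * gam P)) ^ (T - s - 1) /
      (1 + \<epsilon>) powr ((1 + \<epsilon>) * real T / (real (reqs P) * gam P)))"

text \<open>The real powers of \<open>1 - \<epsilon>\<close>, one of them a denominator, make sense only for \<open>\<epsilon> < 1\<close>.\<close>

definition psi :: "mcp \<Rightarrow> real \<Rightarrow> nat \<Rightarrow> (nat \<Rightarrow> real) \<Rightarrow> nat \<Rightarrow> nat \<Rightarrow> real" where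
  "psi P \<epsilon> T Sy s i = 1 / dem P i *
     ((1 - \<epsilon>) powr (Sy i / (gam P * dem P i)) *
      (1 - \<epsilon> / (real (reqs P) * gam P)) ^ (T - s - 1) /
      (1 - \<epsilon>) powr ((1 - \<epsilon>) * real T / (real (reqs P) * gam P)))"

definition cost :: "mcp \<Rightarrow> real \<Rightarrow> nat \<Rightarrow> (nat \<Rightarrow> real) \<Rightarrow> (nat \<Rightarrow> real) \<Rightarrow> nat \<Rightarrow> nat \<Rightarrow> nat \<Rightarrow> real" where
  "cost P \<epsilon> T Sx Sy s j k =
     (\<Sum>i<idxs P. pack P i j k * phi P \<epsilon> T Sx s i) - (\<Sum>i<idxs P. cov P i j k * psi P \<epsilon> T Sy s i)"

text \<open>\<open>steps P \<epsilon> T orc s\<close> is the joint distribution of \<open>S\<^sup>x\<close>, \<open>S\<^sup>y\<close> and the number of oracle calls after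
  \<open>s\<close> of the \<open>T\<close> steps. Minimizing the cost over all options and the null option (of cost 0) is
  one oracle call with the negated cost vector.\<close>

primrec steps :: "mcp \<Rightarrow> real \<Rightarrow> nat \<Rightarrow> (nat \<Rightarrow> (nat \<Rightarrow> real) \<Rightarrow> nat option) \<Rightarrow> nat \<Rightarrow>
    ((nat \<Rightarrow> real) \<times> (nat \<Rightarrow> real) \<times> nat) pmf" where
  "steps P \<epsilon> T orc 0 = return_pmf (\<lambda>_. 0, \<lambda>_. 0, 0)"
| "steps P \<epsilon> T orc (Suc s) = do {
     (Sx, Sy, calls) \<leftarrow> steps P \<epsilon> T orc s;
     j \<leftarrow> pmf_of_set {..<reqs P};
     let y = choice_vec (orc j (\<lambda>k. - cost P \<epsilon> T Sx Sy s j k));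
     return_pmf (\<lambda>i. Sx i + (\<Sum>k<opts P. pack P i j k * y k),
                 \<lambda>i. Sy i + (\<Sum>k<opts P. cov P i j k * y k),
                 calls + 1)
   }"

datatype answer = YES | NO

definition accepts :: "mcp \<Rightarrow> real \<Rightarrow> nat \<Rightarrow> (nat \<Rightarrow> real) \<Rightarrow> (nat \<Rightarrow> real) \<Rightarrow> bool" where
  "accepts P \<epsilon> T Sx Sy \<longleftrightarrow> (\<forall>i<idxs P.
     Sx i < real T * cap P i / real (reqs P) * (1 + \<epsilon>) \<and>
     Sy i > real T * dem P i / real (reqs P) * (1 - \<epsilon>))"

definition algorithm3 :: "mcp \<Rightarrow> real \<Rightarrow> nat \<Rightarrow> (nat \<Rightarrow> (nat \<Rightarrow> real) \<Rightarrow> nat option) \<Rightarrow>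
    (answer \<times> nat) pmf" where
  "algorithm3 P \<epsilon> T orc = do {
     (Sx, Sy, calls) \<leftarrow> steps P \<epsilon> T orc T;
     return_pmf (if accepts P \<epsilon> T Sx Sy then YES else NO, calls)
   }"

text \<open>The number of samples \<open>\<Theta>(\<gamma> m log(n/\<delta>) / \<epsilon>\<^sup>2)\<close> with constant \<open>C\<close>, rounded up. As usual in such
  bounds the logarithm is kept away from 0; the maximum is \<open>n/\<delta>\<close> itself unless \<open>n < 2\<delta>\<close>, so for
  \<open>\<delta> < 1\<close> it matters only when \<open>n = 1\<close> and \<open>\<delta> > 1/2\<close>. There it is needed: as \<open>\<delta>\<close> tends to 1
  the plain formula gives a single sample, with which the algorithm can fail surely.\<close>

definition num_samples :: "real \<Rightarrow> mcp \<Rightarrow> real \<Rightarrow> real \<Rightarrow> nat" where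
  "num_samples C P \<epsilon> \<delta> =
     nat \<lceil>C * (gam P * real (reqs P) * ln (max 2 (real (idxs P) / \<delta>)) / \<epsilon>\<^sup>2)\<rceil>"

end

theory Submission imports Defs begin

text \<open>
  On a YES instance, a feasible solution shows that the oracle's choice keeps the expectation of the
  pessimistic estimator \<open>\<Sum>\<^sub>i c\<^sub>i \<phi>\<^sub>i + d\<^sub>i \<psi>\<^sub>i\<close> (with one more factor \<open>1 \<plusminus> \<epsilon>/(m\<gamma>)\<close>) from growing;
  it is at least 1 whenever the algorithm rejects.

  On a NO instance neither LP duality nor randomized rounding is needed. Take the integral assignment
  minimizing the potential \<open>\<Sum>\<^sub>i exp (\<theta>(S\<^sub>i - 1)) + exp (\<theta>(1 - R\<^sub>i))\<close>, where \<open>S\<^sub>i\<close> and \<open>R\<^sub>i\<close> are its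
  normalized packing and covering loads and \<open>\<theta> = \<epsilon>/(10\<gamma>)\<close>. Changing a single request does not
  decrease the potential, so the summands serve as dual prices for which every option of request \<open>j\<close>
  gains at most some \<open>h j\<close>. Since the assignment violates a relaxed constraint, the potential is so
  large that \<open>\<Sum>\<^sub>j h j\<close> lies below what acceptance requires by an \<open>\<epsilon>\<close> fraction. As \<open>h j\<close> depends only
  on the sampled request and not on the history, a Chernoff bound finishes the proof.
\<close>


section \<open>Supermartingale bounds for the run of the algorithm\<close>

definition load :: "mcp \<Rightarrow> (nat \<Rightarrow> nat \<Rightarrow> nat \<Rightarrow> real) \<Rightarrow> nat \<Rightarrow> (nat \<Rightarrow> real) \<Rightarrow> nat \<Rightarrow> real" where
  "load P a j y i = (\<Sum>k<opts P. a i j k * y k)"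

definition chosen :: "mcp \<Rightarrow> real \<Rightarrow> nat \<Rightarrow> (nat \<Rightarrow> (nat \<Rightarrow> real) \<Rightarrow> nat option) \<Rightarrow> nat \<Rightarrow>
    (nat \<Rightarrow> real) \<Rightarrow> (nat \<Rightarrow> real) \<Rightarrow> nat \<Rightarrow> nat \<Rightarrow> real" where
  "chosen P \<epsilon> T orc s Sx Sy j = choice_vec (orc j (\<lambda>k. - cost P \<epsilon> T Sx Sy s j k))"

lemma steps_Suc:
  "steps P \<epsilon> T orc (Suc s) = bind_pmf (steps P \<epsilon> T orc s) (\<lambda>(Sx, Sy, n).
     map_pmf (\<lambda>j. (\<lambda>i. Sx i + load P (pack P) j (chosen P \<epsilon> T orc s Sx Sy j) i,
                    \<lambda>i. Sy i + load P (cov P) j (chosen P \<epsilon> T orc s Sx Sy j) i, n + 1))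
       (pmf_of_set {..<reqs P}))"
  by (simp add: load_def chosen_def map_pmf_def Let_def case_prod_beta)

text \<open>Averaged over the uniformly drawn request, \<open>step\<close> says that the conditional
  expectation of \<open>V\<close> does not grow; induction on the number of steps finishes.
  Integrating in \<open>ennreal\<close> avoids integrability side conditions, and as
  \<open>step\<close> ranges over all states, no invariant of the reachable ones is carried
  along.\<close>

lemma steps_potential_le:
  fixes V :: "nat \<Rightarrow> (nat \<Rightarrow> real) \<Rightarrow> (nat \<Rightarrow> real) \<Rightarrow> real"
  assumes reqs: "0 < reqs P" and nonneg: "\<And>s Sx Sy. 0 \<le> V s Sx Sy"
    and step: "\<And>s Sx Sy. s < t \<Longrightarrow>
      (\<Sum>j<reqs P. V (Suc s) (\<lambda>i. Sx i + load P (pack P) j (chosen P \<epsilon> T orc s Sx Sy j) i)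
                            (\<lambda>i. Sy i + load P (cov P) j (chosen P \<epsilon> T orc s Sx Sy j) i))
      \<le> real (reqs P) * V s Sx Sy"
  shows "(\<integral>\<^sup>+ (Sx, Sy, n). ennreal (V t Sx Sy) \<partial>steps P \<epsilon> T orc t)
    \<le> ennreal (V 0 (\<lambda>_. 0) (\<lambda>_. 0))"
  using step
proof (induction t)
  case 0
  then show ?case by simp
next
  case (Suc t)
  have ne: "{..<reqs P} \<noteq> {}" using reqs by auto
  have avg: "(\<integral>\<^sup>+ x. ennreal (f x) \<partial>pmf_of_set {..<reqs P}) \<le> ennreal v"
    if "\<And>j. 0 \<le> f j" "(\<Sum>j<reqs P. f j) \<le> real (reqs P) * v" for f :: "nat \<Rightarrow> real" and v
  proof -
    have "(\<integral>\<^sup>+ x. ennreal (f x) \<partial>pmf_of_set {..<reqs P}) = (\<Sum>j<reqs P. ennreal (f j)) / reqs P"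
      using ne by (simp add: nn_integral_pmf_of_set)
    also have "\<dots> = ennreal ((\<Sum>j<reqs P. f j) / real (reqs P))"
      using that reqs
      by (simp add: divide_ennreal sum_nonneg ennreal_of_nat_eq_real_of_nat del: of_nat_sum)
    also have "\<dots> \<le> ennreal v"
      using that reqs by (intro ennreal_leI) (simp add: field_simps)
    finally show ?thesis .
  qed
  have "(\<integral>\<^sup>+ (Sx, Sy, n). ennreal (V (Suc t) Sx Sy) \<partial>steps P \<epsilon> T orc (Suc t))
    \<le> (\<integral>\<^sup>+ (Sx, Sy, n). ennreal (V t Sx Sy) \<partial>steps P \<epsilon> T orc t)"
    unfolding steps_Suc nn_integral_bind_pmf
    by (intro nn_integral_mono) (auto simp: nonneg intro!: avg Suc.prems)
  also have "\<dots> \<le> ennreal (V 0 (\<lambda>_. 0) (\<lambda>_. 0))"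
    by (rule Suc.IH) (use Suc.prems in auto)
  finally show ?case .
qed

text \<open>Markov's inequality: \<open>V t\<close> is nonnegative and at least 1 on the bad states,
  so it dominates their indicator. Both error bounds are instances, each with its own
  \<open>V\<close>.\<close>

lemma steps_prob_le:
  fixes V :: "nat \<Rightarrow> (nat \<Rightarrow> real) \<Rightarrow> (nat \<Rightarrow> real) \<Rightarrow> real"
  assumes reqs: "0 < reqs P" and nonneg: "\<And>s Sx Sy. 0 \<le> V s Sx Sy"
    and step: "\<And>s Sx Sy. s < t \<Longrightarrow>
      (\<Sum>j<reqs P. V (Suc s) (\<lambda>i. Sx i + load P (pack P) j (chosen P \<epsilon> T orc s Sx Sy j) i)
                            (\<lambda>i. Sy i + load P (cov P) j (chosen P \<epsilon> T orc s Sx Sy j) i))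
      \<le> real (reqs P) * V s Sx Sy"
    and bad: "\<And>Sx Sy. bad Sx Sy \<Longrightarrow> 1 \<le> V t Sx Sy"
  shows "measure_pmf.prob (steps P \<epsilon> T orc t) {(Sx, Sy, n). bad Sx Sy} \<le> V 0 (\<lambda>_. 0) (\<lambda>_. 0)"
proof -
  have "emeasure (steps P \<epsilon> T orc t) {(Sx, Sy, n). bad Sx Sy}
    = (\<integral>\<^sup>+ x. indicator {(Sx, Sy, n). bad Sx Sy} x \<partial>steps P \<epsilon> T orc t)"
    by simp
  also have "\<dots> \<le> (\<integral>\<^sup>+ (Sx, Sy, n). ennreal (V t Sx Sy) \<partial>steps P \<epsilon> T orc t)"
    by (intro nn_integral_mono) (auto simp: indicator_def bad split: prod.splits)
  also have "\<dots> \<le> ennreal (V 0 (\<lambda>_. 0) (\<lambda>_. 0))"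
    using steps_potential_le[OF reqs nonneg step] .
  finally show ?thesis
    using nonneg by (simp add: measure_pmf.emeasure_eq_measure)
qed

lemma algorithm3_prob:
  "measure_pmf.prob (algorithm3 P \<epsilon> T orc) {r. fst r = NO}
     = measure_pmf.prob (steps P \<epsilon> T orc T) {(Sx, Sy, n). \<not> accepts P \<epsilon> T Sx Sy}"
  "measure_pmf.prob (algorithm3 P \<epsilon> T orc) {r. fst r = YES}
     = measure_pmf.prob (steps P \<epsilon> T orc T) {(Sx, Sy, n). accepts P \<epsilon> T Sx Sy}"
proof -
  have *: "algorithm3 P \<epsilon> T orc =
      map_pmf (\<lambda>(Sx, Sy, n). (if accepts P \<epsilon> T Sx Sy then YES else NO, n)) (steps P \<epsilon> T orc T)"
    by (auto simp: algorithm3_def map_pmf_def intro!: bind_pmf_cong)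
  show "measure_pmf.prob (algorithm3 P \<epsilon> T orc) {r. fst r = NO}
     = measure_pmf.prob (steps P \<epsilon> T orc T) {(Sx, Sy, n). \<not> accepts P \<epsilon> T Sx Sy}"
    unfolding * measure_map_pmf by (rule arg_cong[where f = "measure_pmf.prob _"]) auto
  show "measure_pmf.prob (algorithm3 P \<epsilon> T orc) {r. fst r = YES}
     = measure_pmf.prob (steps P \<epsilon> T orc T) {(Sx, Sy, n). accepts P \<epsilon> T Sx Sy}"
    unfolding * measure_map_pmf by (rule arg_cong[where f = "measure_pmf.prob _"])
      (auto split: if_splits)
qed

lemma algorithm3_prob_compl:
  "measure_pmf.prob (algorithm3 P \<epsilon> T orc) {r. fst r = NO}
     = 1 - measure_pmf.prob (algorithm3 P \<epsilon> T orc) {r. fst r = YES}"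
proof -
  have "{r :: answer \<times> nat. fst r = NO} = UNIV - {r. fst r = YES}"
    by (auto intro: answer.exhaust)
  then show ?thesis
    using measure_pmf.prob_compl[of "{r. fst r = YES}" "algorithm3 P \<epsilon> T orc"] by simp
qed

lemma steps_calls: "r \<in> set_pmf (steps P \<epsilon> T orc s) \<Longrightarrow> snd (snd r) = s"
  by (induction s arbitrary: r) (auto simp: steps_Suc simp del: steps.simps(2))

lemma algorithm3_calls: "r \<in> set_pmf (algorithm3 P \<epsilon> T orc) \<Longrightarrow> snd r = T"
  by (auto simp: algorithm3_def dest: steps_calls)

section \<open>Bounds on \<gamma> and on the load of a single request\<close>

lemma finite_gam_sets:
  "finite {pack P i j k / cap P i | i j k. i < idxs P \<and> j < reqs P \<and> k < opts P}"
  "finite {cov P i j k / dem P i | i j k. i < idxs P \<and> j < reqs P \<and> k < opts P}"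
proof -
  have *: "{f i j k | i j k. i < idxs P \<and> j < reqs P \<and> k < opts P}
      = (\<lambda>(i, j, k). f i j k) ` ({..<idxs P} \<times> {..<reqs P} \<times> {..<opts P})"
    for f :: "nat \<Rightarrow> nat \<Rightarrow> nat \<Rightarrow> real" by (auto simp: image_iff) blast
  show "finite {pack P i j k / cap P i | i j k. i < idxs P \<and> j < reqs P \<and> k < opts P}"
    and "finite {cov P i j k / dem P i | i j k. i < idxs P \<and> j < reqs P \<and> k < opts P}"
    unfolding * by auto
qed

lemma gam_bounds:
  assumes "wf_mcp P" "i < idxs P" "j < reqs P" "k < opts P"
  shows "pack P i j k \<le> gam P * cap P i" "cov P i j k \<le> gam P * dem P i" "0 \<le> gam P"
proof -
  have pos: "0 < cap P i" "0 < dem P i" "0 \<le> pack P i j k"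
    using assms by (auto simp: wf_mcp_def)
  have "pack P i j k / cap P i \<le> gam P"
    unfolding gam_def by (rule Max_ge) (use assms finite_gam_sets in auto)
  moreover have "cov P i j k / dem P i \<le> gam P"
    unfolding gam_def by (rule Max_ge) (use assms finite_gam_sets in auto)
  ultimately show "pack P i j k \<le> gam P * cap P i" "cov P i j k \<le> gam P * dem P i"
    using pos by (simp_all add: field_simps)
  show "0 \<le> gam P"
    using \<open>pack P i j k / cap P i \<le> gam P\<close> pos by (meson divide_nonneg_pos order_trans)
qed

lemma choice_vec_in_choice_vectors: "choice_vec k \<in> choice_vectors P"
proof -
  have "(\<Sum>k'<opts P. choice_vec k k') \<le> 1"
  proof (cases k)
    case None
    then show ?thesis by (simp add: choice_vec_def)
  next
    case (Some l)
    then show ?thesis by (simp add: choice_vec_def)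
  qed
  then show ?thesis by (simp add: choice_vectors_def choice_vec_def)
qed

lemma load_nonneg:
  assumes "y \<in> choice_vectors P" "\<And>k. k < opts P \<Longrightarrow> 0 \<le> a i j k"
  shows "0 \<le> load P a j y i"
  unfolding load_def using assms by (intro sum_nonneg) (fastforce simp: choice_vectors_def)

lemma load_le:
  assumes "y \<in> choice_vectors P" "\<And>k. k < opts P \<Longrightarrow> a i j k \<le> b" "0 \<le> b"
  shows "load P a j y i \<le> b"
proof -
  have "load P a j y i \<le> (\<Sum>k<opts P. b * y k)"
    unfolding load_def using assms
    by (intro sum_mono mult_right_mono) (fastforce simp: choice_vectors_def)+
  also have "\<dots> = b * (\<Sum>k<opts P. y k)" by (simp add: sum_distrib_left)
  also have "\<dots> \<le> b * 1"
    using assms by (intro mult_left_mono) (auto simp: choice_vectors_def)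
  finally show ?thesis by simp
qed

text \<open>Relative to capacity or demand, all loads lie between 0 and \<gamma>, the range on which
  the exponential estimates below are applied.\<close>

lemma load_bounds:
  assumes "wf_mcp P" "i < idxs P" "j < reqs P" "y \<in> choice_vectors P"
  shows "0 \<le> load P (pack P) j y i" "load P (pack P) j y i \<le> gam P * cap P i"
    "0 \<le> load P (cov P) j y i" "load P (cov P) j y i \<le> gam P * dem P i"
proof -
  have "0 \<le> gam P" using gam_bounds(3)[OF assms(1-3), of 0] assms by (auto simp: wf_mcp_def)
  moreover have "0 < cap P i" "0 < dem P i" using assms by (auto simp: wf_mcp_def)
  ultimately show "load P (pack P) j y i \<le> gam P * cap P i"
    "load P (cov P) j y i \<le> gam P * dem P i"
    using gam_bounds[OF assms(1-3)] by (auto intro!: load_le assms)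
  show "0 \<le> load P (pack P) j y i" "0 \<le> load P (cov P) j y i"
    using assms by (auto intro!: load_nonneg simp: wf_mcp_def)
qed

lemma feasible_load:
  assumes "feasible P x"
  shows "j < reqs P \<Longrightarrow> x j \<in> choice_vectors P"
    "i < idxs P \<Longrightarrow> (\<Sum>j<reqs P. load P (pack P) j (x j) i) \<le> cap P i"
    "i < idxs P \<Longrightarrow> dem P i \<le> (\<Sum>j<reqs P. load P (cov P) j (x j) i)"
  using assms by (auto simp: feasible_def load_def)

section \<open>Convexity and Chernoff estimates\<close>

text \<open>The chord of a convex exponential over [0, 1] lies above its graph. Applied with the
  bases \<open>1 + \<epsilon>\<close>, \<open>1 - \<epsilon>\<close> and
  \<open>exp \<tau>\<close>.\<close>

lemma powr_le_affine:
  fixes b z :: real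
  assumes "0 < b" "0 \<le> z" "z \<le> 1"
  shows "b powr z \<le> 1 + (b - 1) * z"
proof -
  have "b powr z = exp ((1 - z) * 0 + z * ln b)" using assms by (simp add: powr_def)
  also have "\<dots> \<le> (1 - z) * exp 0 + z * exp (ln b)"
    using convex_onD[OF exp_convex, of z 0 "ln b"] assms by simp
  also have "\<dots> = 1 + (b - 1) * z" using assms by (simp add: algebra_simps)
  finally show ?thesis .
qed

text \<open>The difference of the two sides vanishes at 0, and its derivative
  \<open>ln (1 + u) - u / 2\<close> is nonnegative because
  \<open>u / 2 \<le> u / (1 + u) \<le> ln (1 + u)\<close> on [0, 1]. This yields the exponent of the
  upper multiplicative Chernoff bound.\<close>

lemma chernoff_upper:
  fixes x :: real
  assumes "0 \<le> x" "x \<le> 1"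
  shows "x + x\<^sup>2 / 4 \<le> (1 + x) * ln (1 + x)"
proof -
  define f where "f = (\<lambda>u::real. (1 + u) * ln (1 + u) - u - u\<^sup>2 / 4)"
  have "f 0 \<le> f x"
  proof (rule DERIV_nonneg_imp_nondecreasing[OF assms(1)])
    fix u assume u: "0 \<le> u" "u \<le> x"
    have "ln (1 / (1 + u)) \<le> 1 / (1 + u) - 1" using u by (intro ln_le_minus_one) auto
    then have "u / (1 + u) \<le> ln (1 + u)" using u by (simp add: ln_div field_simps)
    moreover have "u / 2 \<le> u / (1 + u)" using u assms by (intro divide_left_mono) auto
    ultimately have "0 \<le> ln (1 + u) - u / 2" by linarith
    moreover have "(f has_real_derivative ln (1 + u) - u / 2) (at u)"
      unfolding f_def using u by (auto intro!: derivative_eq_intros)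
    ultimately show "\<exists>y. (f has_real_derivative y) (at u) \<and> 0 \<le> y" by blast
  qed
  then show ?thesis by (simp add: f_def)
qed

text \<open>The lower tail, by the same derivative argument, now from
  \<open>ln (1 - u) \<le> - u\<close>. Sharing the constant 1/4 with the upper tail lets one
  exponential bound both.\<close>

lemma chernoff_lower:
  fixes x :: real
  assumes "0 \<le> x" "x < 1"
  shows "- x + x\<^sup>2 / 4 \<le> (1 - x) * ln (1 - x)"
proof -
  define f where "f = (\<lambda>u::real. (1 - u) * ln (1 - u) + u - u\<^sup>2 / 4)"
  have "f 0 \<le> f x"
  proof (rule DERIV_nonneg_imp_nondecreasing[OF assms(1)])
    fix u assume u: "0 \<le> u" "u \<le> x"
    have "ln (1 - u) \<le> - u" using ln_le_minus_one[of "1 - u"] u assms by auto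
    then have "0 \<le> - ln (1 - u) - u / 2" using u by simp
    moreover have "(f has_real_derivative - ln (1 - u) - u / 2) (at u)"
      unfolding f_def using u assms by (auto intro!: derivative_eq_intros)
    ultimately show "\<exists>y. (f has_real_derivative y) (at u) \<and> 0 \<le> y" by blast
  qed
  then show ?thesis by (simp add: f_def)
qed


section \<open>Dual prices from an assignment of least potential\<close>

text \<open>With \<open>z = \<theta> * (u - v)\<close>, the square in
  \<open>exp z \<le> 1 + z + z^2\<close> is at most \<open>\<eta> * \<theta> * (u + v)\<close>.
  Splitting it between \<open>u\<close> and \<open>v\<close> makes the effect of exchanging load
  \<open>v\<close> for load \<open>u\<close> linear, with each coefficient distorted only by
  \<open>1 + \<eta>\<close> or \<open>1 - \<eta>\<close>.\<close>

lemma exp_minus_one_le: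
  fixes u v \<theta> \<eta> :: real
  assumes "0 \<le> u" "0 \<le> v" "0 < \<theta>" "\<theta> * u \<le> \<eta>" "\<theta> * v \<le> \<eta>" "\<eta> \<le> 1"
  shows "exp (\<theta> * (u - v)) - 1 \<le> \<theta> * ((1 + \<eta>) * u - (1 - \<eta>) * v)"
proof -
  define z where "z = \<theta> * (u - v)"
  have nn: "0 \<le> \<theta> * u" "0 \<le> \<theta> * v" using assms by auto
  have z: "\<bar>z\<bar> \<le> \<eta>" "\<bar>z\<bar> \<le> \<theta> * u + \<theta> * v"
    unfolding z_def right_diff_distrib using assms(4,5) nn by linarith+
  have "exp z \<le> 1 + z + z\<^sup>2"
  proof (cases "0 \<le> z")
    case True
    then show ?thesis using exp_bound[of z] z assms by auto
  next
    case False
    have "exp z * (1 - z) \<le> exp z * exp (- z)"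
      using exp_ge_add_one_self[of "- z"] by (intro mult_left_mono) auto
    also have "\<dots> = 1" by (simp flip: exp_add)
    \<comment> \<open>The product telescopes to \<open>1 - z^3\<close>, and \<open>z\<close> is
      negative here.\<close>
    also have "\<dots> \<le> (1 + z + z\<^sup>2) * (1 - z)"
    proof -
      have "z * z\<^sup>2 \<le> 0" using False by (intro mult_nonpos_nonneg) auto
      then show ?thesis by (simp add: algebra_simps power2_eq_square)
    qed
    finally show ?thesis using False by (simp add: mult_le_cancel_right)
  qed
  moreover have "z\<^sup>2 \<le> \<eta> * (\<theta> * u + \<theta> * v)"
    using mult_mono[OF z] z by (simp add: power2_eq_square abs_mult_self_eq)
  ultimately show ?thesis unfolding z_def by (simp add: algebra_simps)
qed

text \<open>From \<open>x * exp (- x) \<le> 1\<close> at \<open>x = \<theta> * u\<close>. With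
  \<open>u\<close> the distance of a constraint from being violated by \<open>b\<close>, its
  weighted distance is at most \<open>exp (\<theta> * b) / \<theta>\<close>; hence weighted averages
  of loads are nearly as bad as a violation by \<open>b\<close> everywhere.\<close>

lemma exp_weight_bound:
  fixes \<theta> b u :: real
  assumes "0 < \<theta>"
  shows "exp (\<theta> * (b - u)) * u \<le> exp (\<theta> * b) / \<theta>"
proof -
  have "\<theta> * u \<le> exp (\<theta> * u)" using exp_ge_add_one_self[of "\<theta> * u"] by linarith
  then have "exp (- (\<theta> * u)) * (\<theta> * u) \<le> exp (- (\<theta> * u)) * exp (\<theta> * u)"
    by (intro mult_left_mono) auto
  then have "exp (\<theta> * b) * (exp (- (\<theta> * u)) * (\<theta> * u)) \<le> exp (\<theta> * b) * 1"
    by (intro mult_left_mono) (auto simp flip: exp_add)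
  moreover have "exp (\<theta> * (b - u)) = exp (\<theta> * b) * exp (- (\<theta> * u))"
    by (simp add: algebra_simps flip: exp_add)
  ultimately show ?thesis using assms by (simp add: field_simps)
qed

text \<open>Loads are normalized so that capacities and demands are 1. \<open>\<kappa>\<close> and
  \<open>\<mu>\<close> are the packing and covering prices, and the total covering weight
  \<open>Q\<close> sets the scale: each \<open>h j\<close> is at most
  \<open>2 * \<gamma> * Q\<close>, whereas their sum misses the value required for acceptance by
  \<open>\<epsilon> * Q\<close>. These are the range and the gap for a Chernoff bound.\<close>

lemma dual_certificate:
  fixes A W :: "nat \<Rightarrow> nat \<Rightarrow> 'o \<Rightarrow> real" and \<gamma> \<epsilon> :: real and n m :: nat
  assumes n: "0 < n" and fin: "finite opt" and null: "o0 \<in> opt"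
    and null0: "\<And>i j. A i j o0 = 0" "\<And>i j. W i j o0 = 0"
    and A: "\<And>i j o'. i < n \<Longrightarrow> j < m \<Longrightarrow> o' \<in> opt \<Longrightarrow> 0 \<le> A i j o' \<and> A i j o' \<le> \<gamma>"
    and W: "\<And>i j o'. i < n \<Longrightarrow> j < m \<Longrightarrow> o' \<in> opt \<Longrightarrow> 0 \<le> W i j o' \<and> W i j o' \<le> \<gamma>"
    and eps: "0 < \<epsilon>" "\<epsilon> < 1 / 3" and gam: "0 < \<gamma>" "\<gamma> * ln (real n / \<epsilon>) \<le> \<epsilon>\<^sup>2 / 40"
    and infeasible: "\<And>f. f \<in> {..<m} \<rightarrow>\<^sub>E opt \<Longrightarrow>
      \<exists>i<n. 1 + 3 * \<epsilon> < (\<Sum>j<m. A i j (f j)) \<or> (\<Sum>j<m. W i j (f j)) < 1 - 3 * \<epsilon>"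
  obtains \<kappa> \<mu> :: "nat \<Rightarrow> real" and h :: "nat \<Rightarrow> real" and Q :: real
  where "\<And>i. 0 \<le> \<kappa> i" "\<And>i. 0 \<le> \<mu> i" "0 < Q"
    "\<And>j o'. j < m \<Longrightarrow> o' \<in> opt \<Longrightarrow> (\<Sum>i<n. \<mu> i * W i j o' - \<kappa> i * A i j o') \<le> h j"
    "\<And>j. j < m \<Longrightarrow> 0 \<le> h j" "\<And>j. j < m \<Longrightarrow> h j \<le> 2 * \<gamma> * Q"
    "(\<Sum>j<m. h j) + \<epsilon> * Q \<le> (\<Sum>i<n. (1 - \<epsilon>) * \<mu> i - (1 + \<epsilon>) * \<kappa> i)"
    "(\<Sum>i<n. (1 - \<epsilon>) * \<mu> i - (1 + \<epsilon>) * \<kappa> i) \<le> Q"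
proof -
  \<comment> \<open>\<open>\<eta>\<close> is the relative linearization error.
    \<open>\<theta>\<close> satisfies \<open>\<theta> * \<gamma> = \<eta>\<close>, so changing one
    request moves every exponent by at most \<open>\<eta>\<close>.\<close>
  define \<eta> where "\<eta> = \<epsilon> / 10"
  define \<theta> where "\<theta> = \<eta> / \<gamma>"
  have \<theta>: "0 < \<theta>" "\<theta> * \<gamma> = \<eta>" using eps gam by (auto simp: \<theta>_def \<eta>_def)
  have \<eta>: "0 < \<eta>" "\<eta> \<le> 1" using eps by (auto simp: \<eta>_def)
  define S where "S = (\<lambda>f i. \<Sum>j<m. A i j (f j))"
  define R where "R = (\<lambda>f i. \<Sum>j<m. W i j (f j))"
  define F where "F = (\<lambda>f. (\<Sum>i<n. exp (\<theta> * (S f i - 1)) + exp (\<theta> * (1 - R f i))))"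
  let ?X = "{..<m} \<rightarrow>\<^sub>E opt"
  have finX: "finite ?X" using fin by (intro finite_PiE) auto
  have neX: "?X \<noteq> {}" using null by (auto simp: PiE_eq_empty_iff)
  obtain f where f: "f \<in> ?X" and fmin: "\<And>g. g \<in> ?X \<Longrightarrow> F f \<le> F g"
    using arg_min_if_finite[OF finX neX, of F] by (metis not_le)
  define p where "p = (\<lambda>i. exp (\<theta> * (S f i - 1)))"
  define q where "q = (\<lambda>i. exp (\<theta> * (1 - R f i)))"
  \<comment> \<open>The value of the minimizer's own option at \<open>j\<close>, with
    \<open>1 + \<eta>\<close> and \<open>1 - \<eta>\<close> swapped against the prices in
    \<open>best\<close>: this is what linearizing an exchange yields for the option removed.\<close>
  define h where "h = (\<lambda>j. \<Sum>i<n. (1 + \<eta>) * q i * W i j (f j) - (1 - \<eta>) * p i * A i j (f j))"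
  define Pt where "Pt = (\<Sum>i<n. p i)"
  define Q where "Q = (\<Sum>i<n. q i)"
  have pq: "0 < p i" "0 < q i" for i by (auto simp: p_def q_def)
  have Q: "0 < Q" unfolding Q_def using n pq by (intro sum_pos) auto
  have Pt: "0 \<le> Pt" unfolding Pt_def using pq by (intro sum_nonneg) (auto intro: less_imp_le)
  have fj: "f j \<in> opt" if "j < m" for j using f that by auto
  have best: "(\<Sum>i<n. (1 - \<eta>) * q i * W i j o' - (1 + \<eta>) * p i * A i j o') \<le> h j"
    if j: "j < m" and o': "o' \<in> opt" for j o'
  proof -
    let ?g = "f(j := o')"
    have "?g \<in> ?X" using PiE_fun_upd[of o' "\<lambda>_. opt" j f "{..<m}"] f j o' by (simp add: insert_absorb)
    then have "F f \<le> F ?g" by (rule fmin)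
    have upd: "(\<Sum>j'<m. B j' (?g j')) = (\<Sum>j'<m. B j' (f j')) + B j o' - B j (f j)"
      for B :: "nat \<Rightarrow> 'o \<Rightarrow> real"
    proof -
      have "(\<Sum>j'<m. B j' (?g j')) = B j o' + (\<Sum>j'\<in>{..<m} - {j}. B j' (?g j'))"
        using j by (subst sum.remove[of _ j]) auto
      also have "(\<Sum>j'\<in>{..<m} - {j}. B j' (?g j')) = (\<Sum>j'\<in>{..<m} - {j}. B j' (f j'))"
        by (intro sum.cong) auto
      also have "\<dots> = (\<Sum>j'<m. B j' (f j')) - B j (f j)"
        using j by (subst sum_diff1) auto
      finally show ?thesis by simp
    qed
    have SR: "S ?g i = S f i + A i j o' - A i j (f j)" "R ?g i = R f i + W i j o' - W i j (f j)" for i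
      unfolding S_def R_def by (rule upd)+
    have "F ?g = (\<Sum>i<n. p i * exp (\<theta> * (A i j o' - A i j (f j))) + q i * exp (\<theta> * (W i j (f j) - W i j o')))"
      unfolding F_def p_def q_def exp_add[symmetric] SR by (simp add: algebra_simps)
    moreover have "F f = (\<Sum>i<n. p i + q i)" by (simp add: F_def p_def q_def)
    ultimately have "0 \<le> (\<Sum>i<n. p i * (exp (\<theta> * (A i j o' - A i j (f j))) - 1)
        + q i * (exp (\<theta> * (W i j (f j) - W i j o')) - 1))"
      using \<open>F f \<le> F ?g\<close> by (simp add: algebra_simps sum.distrib sum_subtractf)
    also have "\<dots> \<le> (\<Sum>i<n. p i * (\<theta> * ((1 + \<eta>) * A i j o' - (1 - \<eta>) * A i j (f j)))
        + q i * (\<theta> * ((1 + \<eta>) * W i j (f j) - (1 - \<eta>) * W i j o')))"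
    proof (intro sum_mono add_mono mult_left_mono exp_minus_one_le)
      fix i assume "i \<in> {..<n}"
      then have i: "i < n" by simp
      have le: "\<theta> * a \<le> \<eta>" if "a \<le> \<gamma>" for a
        using mult_left_mono[OF that, of \<theta>] \<theta> by simp
      show "0 \<le> A i j o'" "0 \<le> A i j (f j)" "0 \<le> W i j o'" "0 \<le> W i j (f j)"
        "\<theta> * A i j o' \<le> \<eta>" "\<theta> * A i j (f j) \<le> \<eta>" "\<theta> * W i j o' \<le> \<eta>" "\<theta> * W i j (f j) \<le> \<eta>"
        using A[OF i j] W[OF i j] fj[OF j] o' le by auto
      show "0 \<le> p i" "0 \<le> q i" using pq[of i] by auto
    qed (use \<theta> \<eta> in auto)
    also have "\<dots> = \<theta> * (h j - (\<Sum>i<n. (1 - \<eta>) * q i * W i j o' - (1 + \<eta>) * p i * A i j o'))"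
      unfolding h_def sum_subtractf[symmetric] sum_distrib_left
      by (intro sum.cong refl) (simp add: algebra_simps)
    finally show ?thesis using \<theta> by (simp add: zero_le_mult_iff)
  qed
  have h_nonneg: "0 \<le> h j" if "j < m" for j
    using best[OF that null] by (simp add: null0)
  have h_le: "h j \<le> 2 * \<gamma> * Q" if j: "j < m" for j
  proof -
    have "h j \<le> (\<Sum>i<n. 2 * \<gamma> * q i)"
      unfolding h_def
    proof (intro sum_mono)
      fix i assume "i \<in> {..<n}"
      then have i: "i < n" by simp
      have "(1 + \<eta>) * q i * W i j (f j) \<le> 2 * q i * \<gamma>"
        using W[OF i j fj[OF j]] pq[of i] \<eta> by (intro mult_mono) auto
      moreover have "0 \<le> (1 - \<eta>) * p i * A i j (f j)"
        using A[OF i j fj[OF j]] pq[of i] \<eta> by auto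
      ultimately show "(1 + \<eta>) * q i * W i j (f j) - (1 - \<eta>) * p i * A i j (f j) \<le> 2 * \<gamma> * q i"
        by (simp add: mult_ac)
    qed
    then show ?thesis by (simp add: Q_def sum_distrib_left)
  qed
  have sum_h: "(\<Sum>j<m. h j) = (1 + \<eta>) * (\<Sum>i<n. q i * R f i) - (1 - \<eta>) * (\<Sum>i<n. p i * S f i)"
    unfolding h_def sum.swap[of _ "{..<n}"]
    by (simp add: S_def R_def sum_subtractf sum_distrib_left mult_ac)
  \<comment> \<open>An intermediate violation level. It must exceed about
    \<open>2 * \<epsilon> + 2 * \<eta> + \<epsilon> / 6\<close> for the comparison of coefficients
    in \<open>gap\<close>, and stay below \<open>3 * \<epsilon>\<close> so that
    \<open>exp (\<theta> * b)\<close> is negligible against the weight of the violated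
    constraint.\<close>
  define b where "b = 5 / 2 * \<epsilon>"
  define K where "K = real n * (exp (\<theta> * b) / \<theta>)"
  have K: "0 \<le> K" using \<theta> by (simp add: K_def)
  have qR: "(\<Sum>i<n. q i * R f i) \<le> (1 - b) * Q + K"
  proof -
    have "q i * R f i \<le> (1 - b) * q i + exp (\<theta> * b) / \<theta>" for i
      using exp_weight_bound[OF \<theta>(1), of b "R f i - 1 + b"] by (simp add: q_def algebra_simps)
    then have "(\<Sum>i<n. q i * R f i) \<le> (\<Sum>i<n. (1 - b) * q i + exp (\<theta> * b) / \<theta>)"
      by (intro sum_mono)
    then show ?thesis by (simp add: Q_def K_def sum.distrib sum_distrib_left)
  qed
  have pS: "(1 + b) * Pt - K \<le> (\<Sum>i<n. p i * S f i)"
  proof -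
    have "(1 + b) * p i - exp (\<theta> * b) / \<theta> \<le> p i * S f i" for i
      using exp_weight_bound[OF \<theta>(1), of b "1 + b - S f i"] by (simp add: p_def algebra_simps)
    then have "(\<Sum>i<n. (1 + b) * p i - exp (\<theta> * b) / \<theta>) \<le> (\<Sum>i<n. p i * S f i)"
      by (intro sum_mono)
    then show ?thesis by (simp add: Pt_def K_def sum_subtractf sum_distrib_left)
  qed
  have big: "exp (\<theta> * (3 * \<epsilon>)) \<le> Pt + Q"
  proof -
    obtain i where i: "i < n" and "1 + 3 * \<epsilon> < S f i \<or> R f i < 1 - 3 * \<epsilon>"
      using infeasible[OF f] by (auto simp: S_def R_def)
    then have "exp (\<theta> * (3 * \<epsilon>)) \<le> p i \<or> exp (\<theta> * (3 * \<epsilon>)) \<le> q i"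
      using \<theta> by (auto simp: p_def q_def)
    moreover have "p i \<le> Pt" "q i \<le> Q"
      unfolding Pt_def Q_def using i pq by (auto intro!: member_le_sum intro: less_imp_le)
    ultimately show ?thesis using Pt Q by linarith
  qed
  \<comment> \<open>\<open>K\<close> carries \<open>exp (\<theta> * b)\<close>, smaller than the
    bound in \<open>big\<close> by the factor \<open>exp (\<theta> * \<epsilon> / 2)\<close>. The
    assumption on \<open>\<gamma>\<close> makes this factor at least \<open>n / \<epsilon>\<close>,
    which pays for the sum over \<open>n\<close> indices and leaves \<open>\<epsilon>\<close>;
    dividing by \<open>\<theta> \<ge> 12\<close> gives the rest.\<close>
  have K_le: "2 * K \<le> \<epsilon> / 6 * (Pt + Q)"
  proof -
    have "3 \<le> real n / \<epsilon>"
    proof -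
      have "3 * \<epsilon> \<le> real n" using eps n by linarith
      then show ?thesis using eps by (simp add: field_simps)
    qed
    have "1 \<le> ln (real n / \<epsilon>)"
      using \<open>3 \<le> real n / \<epsilon>\<close> exp_le by (subst ln_ge_iff) linarith+
    have \<theta>\<epsilon>: "4 * ln (real n / \<epsilon>) \<le> \<theta> * \<epsilon>"
    proof -
      have "\<theta> * \<epsilon> = \<epsilon>\<^sup>2 / (10 * \<gamma>)" by (simp add: \<theta>_def \<eta>_def power2_eq_square)
      moreover have "4 * ln (real n / \<epsilon>) \<le> \<epsilon>\<^sup>2 / (10 * \<gamma>)" using gam by (simp add: field_simps)
      ultimately show ?thesis by simp
    qed
    have "exp (- (\<theta> * \<epsilon> / 2)) \<le> exp (- ln (real n / \<epsilon>))"
      using \<theta>\<epsilon> \<open>1 \<le> ln _\<close> by simp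
    also have "\<dots> = \<epsilon> / real n"
      using n eps by (simp add: exp_minus)
    finally have e: "real n * exp (- (\<theta> * \<epsilon> / 2)) \<le> \<epsilon>" using n by (simp add: field_simps)
    have "exp (\<theta> * b) = exp (- (\<theta> * \<epsilon> / 2)) * exp (\<theta> * (3 * \<epsilon>))"
      by (simp add: b_def algebra_simps flip: exp_add)
    then have "\<theta> * K = real n * exp (- (\<theta> * \<epsilon> / 2)) * exp (\<theta> * (3 * \<epsilon>))"
      using \<theta> by (simp add: K_def)
    also have "\<dots> \<le> \<epsilon> * (Pt + Q)"
      using e big eps by (intro mult_mono) auto
    finally have "\<theta> * K \<le> \<epsilon> * (Pt + Q)" .
    moreover have "12 \<le> \<theta>"
    proof -
      have "4 \<le> \<theta> * \<epsilon>" using \<theta>\<epsilon> \<open>1 \<le> ln _\<close> by linarith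
      also have "\<dots> \<le> \<theta> * (1 / 3)" using \<theta> eps by (intro mult_left_mono) auto
      finally show ?thesis by simp
    qed
    then have "12 * K \<le> \<theta> * K" using K by (intro mult_right_mono) auto
    ultimately show ?thesis by simp
  qed
  define D where "D = (1 - \<epsilon>) * (1 - \<eta>) * Q - (1 + \<epsilon>) * (1 + \<eta>) * Pt"
  have D: "(\<Sum>i<n. (1 - \<epsilon>) * ((1 - \<eta>) * q i) - (1 + \<epsilon>) * ((1 + \<eta>) * p i)) = D"
    by (simp add: D_def Q_def Pt_def sum_subtractf sum_distrib_left mult.assoc)
  \<comment> \<open>Coefficients are compared separately for \<open>Q\<close> and for
    \<open>Pt\<close>; the error \<open>2 * K\<close> adds \<open>\<epsilon> / 6\<close> to
    each.\<close>
  have gap: "(\<Sum>j<m. h j) + \<epsilon> * Q \<le> D"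
  proof -
    have "(\<Sum>j<m. h j) \<le> (1 + \<eta>) * ((1 - b) * Q + K) - (1 - \<eta>) * ((1 + b) * Pt - K)"
      unfolding sum_h using qR pS \<eta> by (intro diff_mono mult_left_mono) auto
    also have "\<dots> = (1 + \<eta>) * (1 - b) * Q - (1 - \<eta>) * (1 + b) * Pt + 2 * K"
      by (simp add: algebra_simps)
    finally have "(\<Sum>j<m. h j) \<le> (1 + \<eta>) * (1 - b) * Q - (1 - \<eta>) * (1 + b) * Pt + \<epsilon> / 6 * (Pt + Q)"
      using K_le by linarith
    moreover have "(1 + \<eta>) * (1 - b) + \<epsilon> / 6 + \<epsilon> \<le> (1 - \<epsilon>) * (1 - \<eta>)"
    proof -
      have "(1 - \<epsilon>) * (1 - \<eta>) - ((1 + \<eta>) * (1 - b) + \<epsilon> / 6 + \<epsilon>) = 2 / 15 * \<epsilon> + 7 / 20 * (\<epsilon> * \<epsilon>)"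
        by (simp add: \<eta>_def b_def field_simps)
      moreover have "0 \<le> 2 / 15 * \<epsilon> + 7 / 20 * (\<epsilon> * \<epsilon>)" using eps by simp
      ultimately show ?thesis by linarith
    qed
    then have "((1 + \<eta>) * (1 - b) + \<epsilon> / 6 + \<epsilon>) * Q \<le> (1 - \<epsilon>) * (1 - \<eta>) * Q"
      using Q by (intro mult_right_mono) auto
    moreover have "(1 + \<epsilon>) * (1 + \<eta>) + \<epsilon> / 6 \<le> (1 - \<eta>) * (1 + b)"
    proof -
      have "\<epsilon> * \<epsilon> \<le> \<epsilon> * (1 / 3)" using eps by (intro mult_left_mono) auto
      moreover have "(1 - \<eta>) * (1 + b) - ((1 + \<epsilon>) * (1 + \<eta>) + \<epsilon> / 6) = 17 / 15 * \<epsilon> - 7 / 20 * (\<epsilon> * \<epsilon>)"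
        by (simp add: \<eta>_def b_def field_simps)
      ultimately show ?thesis using eps by linarith
    qed
    then have "((1 + \<epsilon>) * (1 + \<eta>) + \<epsilon> / 6) * Pt \<le> (1 - \<eta>) * (1 + b) * Pt"
      using Pt by (intro mult_right_mono) auto
    ultimately show ?thesis unfolding D_def by (simp add: algebra_simps add_divide_distrib)
  qed
  have "D \<le> Q"
  proof -
    have "(1 - \<epsilon>) * (1 - \<eta>) * Q \<le> 1 * Q"
      using eps \<eta> Q by (intro mult_right_mono mult_le_one) auto
    moreover have "0 \<le> (1 + \<epsilon>) * (1 + \<eta>) * Pt" using eps \<eta> Pt by auto
    ultimately show ?thesis by (simp add: D_def)
  qed
  show ?thesis
  proof (rule that[of "\<lambda>i. (1 + \<eta>) * p i" "\<lambda>i. (1 - \<eta>) * q i" Q h])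
    show "0 \<le> (1 + \<eta>) * p i" "0 \<le> (1 - \<eta>) * q i" for i
      using pq[of i] \<eta> by auto
  qed (use Q best h_nonneg h_le gap D \<open>D \<le> Q\<close> in auto)
qed


section \<open>YES instances: the pessimistic estimator\<close>

lemma sum_cost_mult:
  "(\<Sum>k<opts P. cost P \<epsilon> T Sx Sy s j k * y k)
     = (\<Sum>i<idxs P. phi P \<epsilon> T Sx s i * load P (pack P) j y i - psi P \<epsilon> T Sy s i * load P (cov P) j y i)"
proof -
  have swap: "(\<Sum>k<opts P. (\<Sum>i<idxs P. a i j k * f i) * y k) = (\<Sum>i<idxs P. f i * load P a j y i)"
    for a f
    unfolding load_def sum_distrib_left sum_distrib_right sum.swap[of _ "{..<opts P}"]
    by (intro sum.cong refl) (simp add: mult_ac)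
  show ?thesis
    by (simp add: cost_def left_diff_distrib sum_subtractf swap)
qed

lemma chosen_optimal:
  assumes "is_oracle P orc" "j < reqs P" "y \<in> choice_vectors P"
  shows "(\<Sum>k<opts P. cost P \<epsilon> T Sx Sy s j k * chosen P \<epsilon> T orc s Sx Sy j k)
    \<le> (\<Sum>k<opts P. cost P \<epsilon> T Sx Sy s j k * y k)"
proof -
  have "(\<Sum>k<opts P. - cost P \<epsilon> T Sx Sy s j k * y k)
    \<le> (\<Sum>k<opts P. - cost P \<epsilon> T Sx Sy s j k * chosen P \<epsilon> T orc s Sx Sy j k)"
    using bspec[OF conjunct2[OF assms(1)[unfolded is_oracle_def, rule_format, OF assms(2)]] assms(3),
        of "\<lambda>k. - cost P \<epsilon> T Sx Sy s j k"]
    unfolding chosen_def .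
  then show ?thesis by (simp add: sum_negf)
qed

text \<open>The bound is the initial value of the estimator, which sums over both constraints of
  every index as a union bound does. The bounds on \<open>gam P\<close> come from the same feasible
  solution, and they make \<open>1 - \<epsilon> * \<rho>\<close> nonnegative.\<close>

lemma reject_prob_le:
  assumes wf: "wf_mcp P" and orc: "is_oracle P orc" and feas: "feasible P x"
    and eps: "0 < \<epsilon>" "\<epsilon> < 1"
  defines "\<rho> \<equiv> 1 / (real (reqs P) * gam P)"
  shows "0 < gam P" and "1 \<le> real (reqs P) * gam P"
    and "measure_pmf.prob (steps P \<epsilon> T orc T) {(Sx, Sy, n). \<not> accepts P \<epsilon> T Sx Sy}
      \<le> real (idxs P) * ((1 + \<epsilon> * \<rho>) ^ T / (1 + \<epsilon>) powr ((1 + \<epsilon>) * real T * \<rho>)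
                       + (1 - \<epsilon> * \<rho>) ^ T / (1 - \<epsilon>) powr ((1 - \<epsilon>) * real T * \<rho>))"
proof -
  define m where "m = reqs P"
  define n where "n = idxs P"
  define \<gamma> where "\<gamma> = gam P"
  have pos: "0 < m" "0 < n" and cd: "\<And>i. i < n \<Longrightarrow> 0 < cap P i" "\<And>i. i < n \<Longrightarrow> 0 < dem P i"
    using wf by (auto simp: wf_mcp_def m_def n_def)
  \<comment> \<open>Index 0 exists, and its demand is met by \<open>m\<close> loads of at most
    \<open>\<gamma> * dem P 0\<close> each.\<close>
  have "dem P 0 \<le> (\<Sum>j<m. load P (cov P) j (x j) 0)"
    using feasible_load(3)[OF feas] pos by (simp add: m_def n_def)
  also have "\<dots> \<le> (\<Sum>j<m. \<gamma> * dem P 0)"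
    using load_bounds(4)[OF wf] feasible_load(1)[OF feas] pos
    by (intro sum_mono) (auto simp: m_def n_def \<gamma>_def)
  finally have "1 * dem P 0 \<le> (real m * \<gamma>) * dem P 0" by simp
  then have m\<gamma>: "1 \<le> real m * \<gamma>" using cd(2)[OF pos(2)] by (simp only: mult_le_cancel_right_pos)
  then show "1 \<le> real (reqs P) * gam P" by (simp add: m_def \<gamma>_def)
  have \<gamma>: "0 < \<gamma>" using m\<gamma> by (metis mult_nonneg_nonpos not_le not_one_le_zero of_nat_0_le_iff order_trans)
  then show "0 < gam P" by (simp add: \<gamma>_def)
  have \<rho>: "0 < \<rho>" "\<rho> \<le> 1" using m\<gamma> pos \<gamma> by (auto simp: \<rho>_def m_def[symmetric] \<gamma>_def[symmetric])
  have \<epsilon>\<rho>: "\<epsilon> * \<rho> \<le> 1" "0 \<le> \<epsilon> * \<rho>" using \<rho> eps mult_le_one[of \<epsilon> \<rho>] by auto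
  define N1 where "N1 = (1 + \<epsilon>) powr ((1 + \<epsilon>) * real T * \<rho>)"
  define N2 where "N2 = (1 - \<epsilon>) powr ((1 - \<epsilon>) * real T * \<rho>)"
  have N: "0 < N1" "0 < N2" using eps by (auto simp: N1_def N2_def)
  define u where "u = (\<lambda>(Sx :: nat \<Rightarrow> real) i. (1 + \<epsilon>) powr (Sx i / (\<gamma> * cap P i)))"
  define v where "v = (\<lambda>(Sy :: nat \<Rightarrow> real) i. (1 - \<epsilon>) powr (Sy i / (\<gamma> * dem P i)))"
  have uv: "0 < u S i" "0 < v S i" for S i using eps by (auto simp: u_def v_def)
  \<comment> \<open>The exponent \<open>T - s\<close> counts the steps to come, one more than in
    \<open>phi\<close> and \<open>psi\<close>: these are the prices at time \<open>s\<close> for the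
    estimator after the next step, whose exponent is \<open>T - Suc s\<close>.\<close>
  define V where "V = (\<lambda>s Sx Sy. \<Sum>i<n. u Sx i * (1 + \<epsilon> * \<rho>) ^ (T - s) / N1 + v Sy i * (1 - \<epsilon> * \<rho>) ^ (T - s) / N2)"
  have phi: "phi P \<epsilon> T Sx s i = u Sx i * (1 + \<epsilon> * \<rho>) ^ (T - s - 1) / N1 / cap P i" for Sx s i
    by (simp add: phi_def u_def N1_def \<rho>_def \<gamma>_def)
  have psi: "psi P \<epsilon> T Sy s i = v Sy i * (1 - \<epsilon> * \<rho>) ^ (T - s - 1) / N2 / dem P i" for Sy s i
    by (simp add: psi_def v_def N2_def \<rho>_def \<gamma>_def)
  have "measure_pmf.prob (steps P \<epsilon> T orc T) {(Sx, Sy, n). \<not> accepts P \<epsilon> T Sx Sy}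
      \<le> V 0 (\<lambda>_. 0) (\<lambda>_. 0)"
  proof (rule steps_prob_le[where V = V and bad = "\<lambda>Sx Sy. \<not> accepts P \<epsilon> T Sx Sy"])
    show "0 < reqs P" using pos by (simp add: m_def)
    show "0 \<le> V s Sx Sy" for s Sx Sy
      unfolding V_def using uv N \<epsilon>\<rho> \<rho> eps
      by (intro sum_nonneg add_nonneg_nonneg divide_nonneg_nonneg mult_nonneg_nonneg zero_le_power)
        (auto intro: less_imp_le)
    show "1 \<le> V T Sx Sy" if rej: "\<not> accepts P \<epsilon> T Sx Sy" for Sx Sy
    proof -
      obtain i where i: "i < n" and
        "real T * cap P i / real m * (1 + \<epsilon>) \<le> Sx i \<or> Sy i \<le> real T * dem P i / real m * (1 - \<epsilon>)"
        using rej unfolding accepts_def n_def m_def by (meson not_less)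
      moreover have "(1 + \<epsilon>) * real T * \<rho> = real T * cap P i / real m * (1 + \<epsilon>) / (\<gamma> * cap P i)"
        "(1 - \<epsilon>) * real T * \<rho> = real T * dem P i / real m * (1 - \<epsilon>) / (\<gamma> * dem P i)"
        using cd[OF i] by (simp_all add: \<rho>_def m_def \<gamma>_def)
      moreover have "0 \<le> \<gamma> * cap P i" "0 \<le> \<gamma> * dem P i" using \<gamma> cd[OF i] by auto
      ultimately have "(1 + \<epsilon>) * real T * \<rho> \<le> Sx i / (\<gamma> * cap P i) \<or> Sy i / (\<gamma> * dem P i) \<le> (1 - \<epsilon>) * real T * \<rho>"
        by (metis divide_right_mono)
      \<comment> \<open>As \<open>1 - \<epsilon>\<close> is below 1, its powers decrease in the
        exponent: too little covering makes \<open>v Sy i\<close> large.\<close>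
      then have "N1 \<le> u Sx i \<or> N2 \<le> v Sy i"
        unfolding N1_def N2_def u_def v_def using eps by (auto intro: powr_mono powr_mono')
      then have "1 \<le> u Sx i / N1 \<or> 1 \<le> v Sy i / N2" using N by simp
      moreover have "0 \<le> u Sx i / N1" "0 \<le> v Sy i / N2" using N uv by (auto intro: less_imp_le)
      ultimately have "1 \<le> u Sx i / N1 + v Sy i / N2" by linarith
      also have "\<dots> \<le> (\<Sum>i<n. u Sx i / N1 + v Sy i / N2)"
        by (rule member_le_sum) (use i N uv in \<open>auto intro!: add_nonneg_nonneg intro: less_imp_le\<close>)
      finally show ?thesis by (simp add: V_def)
    qed
    show "(\<Sum>j<reqs P. V (Suc s) (\<lambda>i. Sx i + load P (pack P) j (chosen P \<epsilon> T orc s Sx Sy j) i)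
                            (\<lambda>i. Sy i + load P (cov P) j (chosen P \<epsilon> T orc s Sx Sy j) i))
      \<le> real (reqs P) * V s Sx Sy" if "s < T" for s Sx Sy
    proof -
      define f where "f = phi P \<epsilon> T Sx s"
      define g where "g = psi P \<epsilon> T Sy s"
      define G where "G = (\<lambda>j y. \<Sum>i<n. f i * load P (pack P) j y i - g i * load P (cov P) j y i)"
      have Ts: "z ^ (T - s) = z * z ^ (T - s - 1)" for z :: real
        using that by (simp add: Suc_diff_Suc flip: power_Suc)
      have f0: "0 \<le> f i" if "i < n" for i
        unfolding f_def phi using uv N \<epsilon>\<rho> \<rho> eps cd(1)[OF that]
        by (intro divide_nonneg_nonneg mult_nonneg_nonneg zero_le_power) (auto intro: less_imp_le)
      have g0: "0 \<le> g i" if "i < n" for i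
        unfolding g_def psi using uv N \<epsilon>\<rho> \<rho> eps cd(2)[OF that]
        by (intro divide_nonneg_nonneg mult_nonneg_nonneg zero_le_power) (auto intro: less_imp_le)
      \<comment> \<open>The common part of the estimator before and after the step. The rest is
        linear: \<open>\<epsilon> * \<rho>\<close> times priced capacities minus priced demands
        before, at most \<open>\<epsilon> / \<gamma>\<close> times the cost \<open>G\<close> of the
        choice after. As \<open>m * \<epsilon> * \<rho> = \<epsilon> / \<gamma>\<close>, summing
        over all requests makes the two comparable.\<close>
      define Z where "Z = (\<Sum>i<n. cap P i * f i + dem P i * g i)"
      have Vs: "V s Sx Sy = (\<Sum>i<n. cap P i * f i * (1 + \<epsilon> * \<rho>) + dem P i * g i * (1 - \<epsilon> * \<rho>))"
        unfolding V_def f_def g_def phi psi Ts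
      proof (intro sum.cong refl)
        fix i assume "i \<in> {..<n}"
        then have "cap P i \<noteq> 0" "dem P i \<noteq> 0" using cd[of i] by auto
        then show "u Sx i * ((1 + \<epsilon> * \<rho>) * (1 + \<epsilon> * \<rho>) ^ (T - s - 1)) / N1 +
          v Sy i * ((1 - \<epsilon> * \<rho>) * (1 - \<epsilon> * \<rho>) ^ (T - s - 1)) / N2 =
          cap P i * (u Sx i * (1 + \<epsilon> * \<rho>) ^ (T - s - 1) / N1 / cap P i) * (1 + \<epsilon> * \<rho>) +
          dem P i * (v Sy i * (1 - \<epsilon> * \<rho>) ^ (T - s - 1) / N2 / dem P i) * (1 - \<epsilon> * \<rho>)"
          by (simp add: mult_ac)
      qed
      also have "\<dots> = Z + \<epsilon> * \<rho> * (\<Sum>i<n. f i * cap P i - g i * dem P i)"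
        unfolding Z_def sum_distrib_left sum.distrib[symmetric]
        by (intro sum.cong refl) (simp add: algebra_simps)
      finally have Vs: "V s Sx Sy = Z + \<epsilon> * \<rho> * (\<Sum>i<n. f i * cap P i - g i * dem P i)" .
      have step: "V (Suc s) (\<lambda>i. Sx i + load P (pack P) j y i) (\<lambda>i. Sy i + load P (cov P) j y i)
        \<le> Z + \<epsilon> / \<gamma> * G j y" if j: "j < m" and y: "y \<in> choice_vectors P" for j y
      proof -
        have "V (Suc s) (\<lambda>i. Sx i + load P (pack P) j y i) (\<lambda>i. Sy i + load P (cov P) j y i)
          \<le> (\<Sum>i<n. cap P i * f i * (1 + \<epsilon> * (load P (pack P) j y i / (\<gamma> * cap P i)))
                + dem P i * g i * (1 - \<epsilon> * (load P (cov P) j y i / (\<gamma> * dem P i))))"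
          unfolding V_def
        proof (intro sum_mono add_mono)
          fix i assume "i \<in> {..<n}"
          then have i: "i < n" by simp
          have b: "0 \<le> load P (pack P) j y i / (\<gamma> * cap P i)" "load P (pack P) j y i / (\<gamma> * cap P i) \<le> 1"
            "0 \<le> load P (cov P) j y i / (\<gamma> * dem P i)" "load P (cov P) j y i / (\<gamma> * dem P i) \<le> 1"
            using load_bounds[OF wf _ _ y, of i j] i j \<gamma> cd[OF i] by (auto simp: n_def m_def \<gamma>_def)
          have "u (\<lambda>i. Sx i + load P (pack P) j y i) i
              = u Sx i * (1 + \<epsilon>) powr (load P (pack P) j y i / (\<gamma> * cap P i))"
            by (simp add: u_def powr_add add_divide_distrib)
          also have "\<dots> \<le> u Sx i * (1 + \<epsilon> * (load P (pack P) j y i / (\<gamma> * cap P i)))"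
            using powr_le_affine[OF _ b(1,2), of "1 + \<epsilon>"] eps uv[of Sx i] by (intro mult_left_mono) auto
          finally have "u (\<lambda>i. Sx i + load P (pack P) j y i) i * (1 + \<epsilon> * \<rho>) ^ (T - s - 1) / N1
            \<le> u Sx i * (1 + \<epsilon> * (load P (pack P) j y i / (\<gamma> * cap P i))) * (1 + \<epsilon> * \<rho>) ^ (T - s - 1) / N1"
            using N \<epsilon>\<rho> by (intro divide_right_mono mult_right_mono) auto
          then show "u (\<lambda>i. Sx i + load P (pack P) j y i) i * (1 + \<epsilon> * \<rho>) ^ (T - Suc s) / N1
            \<le> cap P i * f i * (1 + \<epsilon> * (load P (pack P) j y i / (\<gamma> * cap P i)))"
            using cd[OF i] by (simp add: f_def phi mult_ac)
          have "v (\<lambda>i. Sy i + load P (cov P) j y i) i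
              = v Sy i * (1 - \<epsilon>) powr (load P (cov P) j y i / (\<gamma> * dem P i))"
            by (simp add: v_def powr_add add_divide_distrib)
          also have "\<dots> \<le> v Sy i * (1 - \<epsilon> * (load P (cov P) j y i / (\<gamma> * dem P i)))"
            using powr_le_affine[OF _ b(3,4), of "1 - \<epsilon>"] eps uv[of Sy i] by (intro mult_left_mono) auto
          finally have "v (\<lambda>i. Sy i + load P (cov P) j y i) i * (1 - \<epsilon> * \<rho>) ^ (T - s - 1) / N2
            \<le> v Sy i * (1 - \<epsilon> * (load P (cov P) j y i / (\<gamma> * dem P i))) * (1 - \<epsilon> * \<rho>) ^ (T - s - 1) / N2"
            using N \<epsilon>\<rho> by (intro divide_right_mono mult_right_mono) auto
          then show "v (\<lambda>i. Sy i + load P (cov P) j y i) i * (1 - \<epsilon> * \<rho>) ^ (T - Suc s) / N2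
            \<le> dem P i * g i * (1 - \<epsilon> * (load P (cov P) j y i / (\<gamma> * dem P i)))"
            using cd[OF i] by (simp add: g_def psi mult_ac)
        qed
        also have "\<dots> = Z + \<epsilon> / \<gamma> * G j y"
          unfolding Z_def G_def sum_distrib_left sum.distrib[symmetric]
        proof (intro sum.cong refl)
          fix i assume "i \<in> {..<n}"
          then have "cap P i \<noteq> 0" "dem P i \<noteq> 0" using cd[of i] by auto
          then show "cap P i * f i * (1 + \<epsilon> * (load P (pack P) j y i / (\<gamma> * cap P i)))
                + dem P i * g i * (1 - \<epsilon> * (load P (cov P) j y i / (\<gamma> * dem P i)))
             = cap P i * f i + dem P i * g i + \<epsilon> / \<gamma> * (f i * load P (pack P) j y i - g i * load P (cov P) j y i)"
            using \<gamma> by (simp add: field_simps)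
        qed
        finally show ?thesis .
      qed
      have "(\<Sum>j<m. V (Suc s) (\<lambda>i. Sx i + load P (pack P) j (chosen P \<epsilon> T orc s Sx Sy j) i)
                            (\<lambda>i. Sy i + load P (cov P) j (chosen P \<epsilon> T orc s Sx Sy j) i))
        \<le> (\<Sum>j<m. Z + \<epsilon> / \<gamma> * G j (x j))"
      proof (rule sum_mono)
        fix j assume "j \<in> {..<m}"
        then have j: "j < m" by simp
        let ?y = "chosen P \<epsilon> T orc s Sx Sy j"
        have "V (Suc s) (\<lambda>i. Sx i + load P (pack P) j ?y i) (\<lambda>i. Sy i + load P (cov P) j ?y i)
          \<le> Z + \<epsilon> / \<gamma> * G j ?y"
          by (rule step[OF j]) (simp add: chosen_def choice_vec_in_choice_vectors)
        also have "G j ?y \<le> G j (x j)"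
          using chosen_optimal[OF orc _ feasible_load(1)[OF feas], of j j \<epsilon> T Sx Sy s] j
          unfolding sum_cost_mult by (simp add: G_def f_def g_def n_def m_def)
        then have "Z + \<epsilon> / \<gamma> * G j ?y \<le> Z + \<epsilon> / \<gamma> * G j (x j)"
          using eps \<gamma> by (intro add_left_mono mult_left_mono) auto
        finally show "V (Suc s) (\<lambda>i. Sx i + load P (pack P) j ?y i) (\<lambda>i. Sy i + load P (cov P) j ?y i)
          \<le> Z + \<epsilon> / \<gamma> * G j (x j)" .
      qed
      also have "\<dots> = real m * Z + \<epsilon> / \<gamma> * (\<Sum>j<m. G j (x j))"
        by (simp add: sum.distrib sum_distrib_left)
      also have "(\<Sum>j<m. G j (x j)) = (\<Sum>i<n. f i * (\<Sum>j<m. load P (pack P) j (x j) i)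
          - g i * (\<Sum>j<m. load P (cov P) j (x j) i))"
        unfolding G_def sum.swap[of _ "{..<n}"] by (simp add: sum_subtractf sum_distrib_left)
      \<comment> \<open>The constraints satisfied by \<open>x\<close>, weighted with nonnegative
        prices.\<close>
      also have "\<epsilon> / \<gamma> * \<dots> \<le> \<epsilon> / \<gamma> * (\<Sum>i<n. f i * cap P i - g i * dem P i)"
        using eps \<gamma> f0 g0 feasible_load(2,3)[OF feas]
        by (intro mult_left_mono sum_mono diff_mono) (auto simp: n_def m_def)
      also have "real m * Z + \<epsilon> / \<gamma> * (\<Sum>i<n. f i * cap P i - g i * dem P i) = real m * V s Sx Sy"
      proof -
        have "real m * (\<epsilon> * \<rho>) = \<epsilon> / \<gamma>"
          using pos by (simp add: \<rho>_def m_def[symmetric] \<gamma>_def[symmetric])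
        then show ?thesis unfolding Vs distrib_left mult.assoc[symmetric] by (simp add: mult.assoc)
      qed
      finally show ?thesis by (simp add: m_def)
    qed
  qed
  also have "V 0 (\<lambda>_. 0) (\<lambda>_. 0) = real (idxs P) * ((1 + \<epsilon> * \<rho>) ^ T / N1 + (1 - \<epsilon> * \<rho>) ^ T / N2)"
    using eps by (simp add: V_def u_def v_def n_def)
  finally show "measure_pmf.prob (steps P \<epsilon> T orc T) {(Sx, Sy, n). \<not> accepts P \<epsilon> T Sx Sy}
      \<le> real (idxs P) * ((1 + \<epsilon> * \<rho>) ^ T / (1 + \<epsilon>) powr ((1 + \<epsilon>) * real T * \<rho>)
                       + (1 - \<epsilon> * \<rho>) ^ T / (1 - \<epsilon>) powr ((1 - \<epsilon>) * real T * \<rho>))"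
    by (simp add: N1_def N2_def)
qed

text \<open>From \<open>1 + x * r \<le> exp (x * r)\<close>. As \<open>x\<close> is signed,
  \<open>x = \<epsilon>\<close> and \<open>x = - \<epsilon>\<close> give the two tails, both with
  \<open>z = \<epsilon>^2 / 4\<close>.\<close>

lemma chernoff_quotient_le:
  fixes x r z :: real
  assumes "0 < x + 1" "0 \<le> 1 + x * r" "0 \<le> r" "x + z \<le> (1 + x) * ln (1 + x)"
  shows "(1 + x * r) ^ T / (1 + x) powr ((1 + x) * real T * r) \<le> exp (- (z * real T * r))"
proof -
  have "(1 + x * r) ^ T \<le> exp (x * r) ^ T"
    using assms by (intro power_mono) auto
  also have "\<dots> = exp (x * (real T * r))" by (simp add: mult_ac flip: exp_of_nat_mult)
  finally have "(1 + x * r) ^ T / (1 + x) powr ((1 + x) * real T * r)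
    \<le> exp (x * (real T * r)) / (1 + x) powr ((1 + x) * real T * r)"
    by (rule divide_right_mono) simp
  also have "\<dots> = exp (x * (real T * r) - (1 + x) * ln (1 + x) * (real T * r))"
    using assms by (simp add: powr_def exp_diff mult_ac)
  also have "\<dots> \<le> exp (- (z * (real T * r)))"
    using mult_right_mono[OF assms(4), of "real T * r"] assms by (simp add: algebra_simps)
  finally show ?thesis by (simp add: mult_ac)
qed

text \<open>Rounding up can only enlarge the sample. The inequality is solved for the quantity that
  occurs in the Chernoff exponents of both cases.\<close>

lemma num_samples_ge:
  assumes "0 < reqs P" "0 < gam P" "0 < \<epsilon>"
  shows "C * ln (max 2 (real (idxs P) / \<delta>))
     \<le> \<epsilon>\<^sup>2 * real (num_samples C P \<epsilon> \<delta>) * (1 / (real (reqs P) * gam P))"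
proof -
  have "C * (gam P * real (reqs P) * ln (max 2 (real (idxs P) / \<delta>)) / \<epsilon>\<^sup>2)
    \<le> real (num_samples C P \<epsilon> \<delta>)"
    unfolding num_samples_def by linarith
  then show ?thesis using assms by (simp add: field_simps)
qed

lemma yes_instance_error:
  assumes wf: "wf_mcp P" and orc: "is_oracle P orc" and yes: "yes_instance P"
    and eps: "0 < \<epsilon>" "\<epsilon> < 1" and \<delta>: "0 < \<delta>" and T: "T = num_samples 8 P \<epsilon> \<delta>"
  shows "measure_pmf.prob (algorithm3 P \<epsilon> T orc) {r. fst r = NO} \<le> \<delta>"
proof -
  obtain x where x: "feasible P x" using yes by (auto simp: yes_instance_def)
  define r where "r = 1 / (real (reqs P) * gam P)"
  define L where "L = ln (max 2 (real (idxs P) / \<delta>))"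
  have n: "0 < idxs P" "0 < reqs P" using wf by (auto simp: wf_mcp_def)
  note bounds = reject_prob_le[OF wf orc x eps, folded r_def]
  have r: "0 \<le> r" "r \<le> 1" using bounds(2) by (auto simp: r_def)
  have \<epsilon>r: "\<epsilon> * r \<le> 1" "0 \<le> \<epsilon> * r" using r eps mult_le_one[of \<epsilon> r] by auto
  have "8 * L \<le> \<epsilon>\<^sup>2 * real T * r"
    unfolding T L_def r_def by (rule num_samples_ge) (use n bounds eps in auto)
  \<comment> \<open>A quarter of \<open>8 * L\<close> is \<open>2 * L\<close>. One factor
    \<open>exp (- L)\<close> is at most 1/2 by the \<open>max 2\<close> in the sample size and
    absorbs the two tails; the other is at most \<open>\<delta> / real (idxs P)\<close> and absorbs
    the union bound.\<close>
  then have "exp (- (\<epsilon>\<^sup>2 / 4 * real T * r)) \<le> exp (- L + - L)" by simp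
  also have "\<dots> = exp (- L) * exp (- L)" by (rule exp_add)
  also have "\<dots> \<le> 1 / 2 * (\<delta> / real (idxs P))"
  proof (intro mult_mono)
    have "exp (- L) = 1 / max 2 (real (idxs P) / \<delta>)"
      by (simp add: L_def exp_minus inverse_eq_divide)
    moreover have "1 / max 2 (real (idxs P) / \<delta>) \<le> 1 / (real (idxs P) / \<delta>)"
      using n \<delta> by (intro divide_left_mono) auto
    moreover have "1 / max 2 (real (idxs P) / \<delta>) \<le> 1 / 2"
      by (intro divide_left_mono) auto
    ultimately show "exp (- L) \<le> 1 / 2" "exp (- L) \<le> \<delta> / real (idxs P)" by auto
  qed auto
  finally have e: "exp (- (\<epsilon>\<^sup>2 / 4 * real T * r)) \<le> 1 / 2 * (\<delta> / real (idxs P))" .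
  have "(1 + \<epsilon> * r) ^ T / (1 + \<epsilon>) powr ((1 + \<epsilon>) * real T * r) \<le> exp (- (\<epsilon>\<^sup>2 / 4 * real T * r))"
    using eps r \<epsilon>r chernoff_upper[of \<epsilon>] by (intro chernoff_quotient_le) auto
  moreover have "(1 - \<epsilon> * r) ^ T / (1 - \<epsilon>) powr ((1 - \<epsilon>) * real T * r) \<le> exp (- (\<epsilon>\<^sup>2 / 4 * real T * r))"
    using eps r \<epsilon>r chernoff_lower[of \<epsilon>] chernoff_quotient_le[of "- \<epsilon>" r "\<epsilon>\<^sup>2 / 4" T] by auto
  ultimately have "real (idxs P) * ((1 + \<epsilon> * r) ^ T / (1 + \<epsilon>) powr ((1 + \<epsilon>) * real T * r)
       + (1 - \<epsilon> * r) ^ T / (1 - \<epsilon>) powr ((1 - \<epsilon>) * real T * r))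
    \<le> real (idxs P) * (\<delta> / real (idxs P))"
    using e by (intro mult_left_mono) linarith+
  also have "\<dots> = \<delta>" using n by simp
  finally show ?thesis using bounds(3)[of T] by (simp add: algorithm3_prob)
qed


section \<open>NO instances: a Chernoff bound at fixed dual prices\<close>

lemma relaxed_simps [simp]:
  "reqs (relaxed \<epsilon> P) = reqs P" "idxs (relaxed \<epsilon> P) = idxs P" "opts (relaxed \<epsilon> P) = opts P"
  "pack (relaxed \<epsilon> P) = pack P" "cov (relaxed \<epsilon> P) = cov P"
  "cap (relaxed \<epsilon> P) i = cap P i * (1 + 3 * \<epsilon> * (1 + \<epsilon>))"
  "dem (relaxed \<epsilon> P) i = dem P i * (1 - 3 * \<epsilon> * (1 + \<epsilon>))"
  "choice_vectors (relaxed \<epsilon> P) = choice_vectors P"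
  by (simp_all add: relaxed_def choice_vectors_def)

text \<open>From \<epsilon> = 1/3 on, all relaxed demands are nonpositive, so choosing nothing is
  feasible. This supplies the range of \<epsilon> for \<open>dual_certificate\<close>.\<close>

lemma no_instance_eps_less:
  assumes wf: "wf_mcp P" and no: "no_instance \<epsilon> P" and eps: "0 < \<epsilon>"
  shows "\<epsilon> < 1 / 3"
proof (rule ccontr)
  assume "\<not> \<epsilon> < 1 / 3"
  then have "1 * 1 \<le> 3 * \<epsilon> * (1 + \<epsilon>)" by (intro mult_mono) auto
  then have "feasible (relaxed \<epsilon> P) (\<lambda>_ _. 0)"
    using wf by (auto simp: feasible_def choice_vectors_def wf_mcp_def mult_nonneg_nonpos less_imp_le)
  then show False using no by (auto simp: no_instance_def)
qed

text \<open>An assignment within slack \<open>3 * \<epsilon>\<close> is also within the wider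
  \<open>3 * \<epsilon> * (1 + \<epsilon>)\<close>, hence feasible for
  \<open>relaxed \<epsilon> P\<close>.\<close>

lemma no_instance_violated:
  assumes wf: "wf_mcp P" and no: "no_instance \<epsilon> P" and eps: "0 < \<epsilon>"
  shows "\<exists>i<idxs P. 1 + 3 * \<epsilon> < (\<Sum>j<reqs P. load P (pack P) j (choice_vec (f j)) i / cap P i) \<or>
     (\<Sum>j<reqs P. load P (cov P) j (choice_vec (f j)) i / dem P i) < 1 - 3 * \<epsilon>"
proof (rule ccontr)
  assume neg: "\<not> ?thesis"
  have "feasible (relaxed \<epsilon> P) (\<lambda>j. choice_vec (f j))"
    unfolding feasible_def
  proof (intro conjI allI impI)
    fix i assume "i < idxs (relaxed \<epsilon> P)"
    then have i: "i < idxs P" by simp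
    have cd: "0 < cap P i" "0 < dem P i" using wf i by (auto simp: wf_mcp_def)
    have "(\<Sum>j<reqs P. load P (pack P) j (choice_vec (f j)) i) / cap P i \<le> 1 + 3 * \<epsilon>"
      "1 - 3 * \<epsilon> \<le> (\<Sum>j<reqs P. load P (cov P) j (choice_vec (f j)) i) / dem P i"
      using neg i unfolding sum_divide_distrib by (meson not_less)+
    moreover have "3 * \<epsilon> \<le> 3 * \<epsilon> * (1 + \<epsilon>)" using eps by (simp add: algebra_simps)
    ultimately have "(\<Sum>j<reqs P. load P (pack P) j (choice_vec (f j)) i) / cap P i \<le> 1 + 3 * \<epsilon> * (1 + \<epsilon>)"
      "1 - 3 * \<epsilon> * (1 + \<epsilon>) \<le> (\<Sum>j<reqs P. load P (cov P) j (choice_vec (f j)) i) / dem P i"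
      by linarith+
    then show "(\<Sum>j<reqs (relaxed \<epsilon> P). \<Sum>k<opts (relaxed \<epsilon> P). pack (relaxed \<epsilon> P) i j k * choice_vec (f j) k)
        \<le> cap (relaxed \<epsilon> P) i"
      "dem (relaxed \<epsilon> P) i
        \<le> (\<Sum>j<reqs (relaxed \<epsilon> P). \<Sum>k<opts (relaxed \<epsilon> P). cov (relaxed \<epsilon> P) i j k * choice_vec (f j) k)"
      using cd by (simp_all add: load_def pos_divide_le_eq pos_le_divide_eq mult.commute)
  qed (simp add: choice_vec_in_choice_vectors)
  then show False using no by (auto simp: no_instance_def)
qed

lemma no_instance_error:
  assumes wf: "wf_mcp P" and orc: "is_oracle P orc" and no: "no_instance \<epsilon> P"
    and eps: "0 < \<epsilon>" "\<epsilon> < 1" and \<delta>: "0 < \<delta>" and T: "T = num_samples 8 P \<epsilon> \<delta>"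
    and gam: "gam P \<le> 1 / 40 * (\<epsilon>\<^sup>2 / ln (real (idxs P) / \<epsilon>))"
  shows "measure_pmf.prob (algorithm3 P \<epsilon> T orc) {r. fst r = YES} \<le> \<delta>"
proof (cases "gam P = 0")
  \<comment> \<open>No samples are drawn then, and acceptance fails because its strict inequalities
    read \<open>0 < 0\<close>.\<close>
  case True
  then have "T = 0" by (simp add: T num_samples_def)
  then have "{(Sx, Sy, n). accepts P \<epsilon> T Sx Sy} \<inter> set_pmf (steps P \<epsilon> T orc T) = {}"
    using wf by (auto simp: accepts_def wf_mcp_def)
  then have "measure_pmf.prob (steps P \<epsilon> T orc T) {(Sx, Sy, n). accepts P \<epsilon> T Sx Sy} = 0"
    by (auto simp: measure_pmf_zero_iff)
  then show ?thesis using \<delta> by (simp add: algorithm3_prob)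
next
  case False
  define m where "m = reqs P"
  define n where "n = idxs P"
  define \<gamma> where "\<gamma> = gam P"
  have pos: "0 < m" "0 < n" "0 < opts P" and cd: "\<And>i. i < n \<Longrightarrow> 0 < cap P i" "\<And>i. i < n \<Longrightarrow> 0 < dem P i"
    using wf by (auto simp: wf_mcp_def m_def n_def)
  have \<gamma>: "0 < \<gamma>" using gam_bounds(3)[OF wf, of 0 0 0] pos False by (simp add: \<gamma>_def m_def n_def)
  have eps3: "\<epsilon> < 1 / 3" by (rule no_instance_eps_less[OF wf no eps(1)])
  \<comment> \<open>Makes the logarithm positive, so that the bound on \<open>gam P\<close> can be
    multiplied by it.\<close>
  have "\<epsilon> < real n" using eps pos by linarith
  then have "0 < ln (real n / \<epsilon>)" using eps by simp
  then have gam': "\<gamma> * ln (real n / \<epsilon>) \<le> \<epsilon>\<^sup>2 / 40"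
    using gam by (simp add: \<gamma>_def n_def field_simps)
  define opt where "opt = insert None (Some ` {..<opts P})"
  define A where "A = (\<lambda>i j k. load P (pack P) j (choice_vec k) i / cap P i)"
  define W where "W = (\<lambda>i j k. load P (cov P) j (choice_vec k) i / dem P i)"
  have AW: "0 \<le> A i j k \<and> A i j k \<le> \<gamma>" "0 \<le> W i j k \<and> W i j k \<le> \<gamma>" if "i < n" "j < m" for i j k
    using load_bounds[OF wf _ _ choice_vec_in_choice_vectors, of i j k] that cd[OF that(1)]
    by (auto simp: A_def W_def n_def m_def \<gamma>_def pos_divide_le_eq)
  obtain \<kappa> \<mu> h Q where \<kappa>: "\<And>i. 0 \<le> \<kappa> i" and \<mu>: "\<And>i. 0 \<le> \<mu> i" and Q: "0 < Q"
    and best: "\<And>j k. j < m \<Longrightarrow> k \<in> opt \<Longrightarrow> (\<Sum>i<n. \<mu> i * W i j k - \<kappa> i * A i j k) \<le> h j"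
    and h: "\<And>j. j < m \<Longrightarrow> 0 \<le> h j" "\<And>j. j < m \<Longrightarrow> h j \<le> 2 * \<gamma> * Q"
    and gap: "(\<Sum>j<m. h j) + \<epsilon> * Q \<le> (\<Sum>i<n. (1 - \<epsilon>) * \<mu> i - (1 + \<epsilon>) * \<kappa> i)"
    and D_le: "(\<Sum>i<n. (1 - \<epsilon>) * \<mu> i - (1 + \<epsilon>) * \<kappa> i) \<le> Q"
  proof (rule dual_certificate[of n opt None A W m \<gamma> \<epsilon>])
    show "\<exists>i<n. 1 + 3 * \<epsilon> < (\<Sum>j<m. A i j (f j)) \<or> (\<Sum>j<m. W i j (f j)) < 1 - 3 * \<epsilon>" for f
      unfolding A_def W_def n_def m_def by (rule no_instance_violated[OF wf no eps(1)])
  qed (use AW pos eps eps3 \<gamma> gam' in \<open>auto simp: opt_def A_def W_def load_def choice_vec_def\<close>)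
  define D where "D = (\<Sum>i<n. (1 - \<epsilon>) * \<mu> i - (1 + \<epsilon>) * \<kappa> i)"
  define H where "H = (\<Sum>j<m. h j)"
  \<comment> \<open>\<open>M\<close> bounds every \<open>h j\<close>, so \<open>h j / M\<close> lies
    in [0, 1]. \<open>\<tau> = \<epsilon> / 2\<close> minimizes
    \<open>\<tau>^2 - \<tau> * \<epsilon>\<close>, which governs the final exponent, and
    \<open>r\<close> will bound the average of \<open>exp (\<tau> / M * h j)\<close> over the
    requests.\<close>
  define M where "M = 2 * \<gamma> * Q"
  define \<tau> where "\<tau> = \<epsilon> / 2"
  define r where "r = exp ((\<tau> + \<tau>\<^sup>2) * H / (real m * M))"
  have M: "0 < M" using \<gamma> Q by (simp add: M_def)
  have \<tau>: "0 < \<tau>" "\<tau> \<le> 1" using eps by (auto simp: \<tau>_def)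
  define G where "G = (\<lambda>Sx Sy. \<Sum>i<n. \<mu> i * (Sy i / dem P i) - \<kappa> i * (Sx i / cap P i))"
  \<comment> \<open>\<open>G\<close> is the priced value collected; acceptance forces it up to
    \<open>real T / real m * D\<close>, where \<open>V T\<close> reaches 1. The factor
    \<open>r ^ (T - s)\<close> pays in advance for the steps to come.\<close>
  define V where "V = (\<lambda>s Sx Sy. exp (\<tau> / M * G Sx Sy) * r ^ (T - s) / exp (\<tau> / M * (real T / real m * D)))"
  have mgf: "(\<Sum>j<m. exp (\<tau> / M * h j)) \<le> real m * r"
  proof -
    have "exp (\<tau> / M * h j) \<le> 1 + (\<tau> + \<tau>\<^sup>2) * (h j / M)" if "j < m" for j
    proof -
      have z: "0 \<le> h j / M" "h j / M \<le> 1" using h[OF that] M by (auto simp: M_def)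
      have "exp (\<tau> / M * h j) = exp \<tau> powr (h j / M)" by (simp add: powr_def)
      also have "\<dots> \<le> 1 + (exp \<tau> - 1) * (h j / M)" by (rule powr_le_affine) (use z in auto)
      also have "\<dots> \<le> 1 + (\<tau> + \<tau>\<^sup>2) * (h j / M)"
        using exp_bound[of \<tau>] \<tau> z by (intro add_left_mono mult_right_mono) auto
      finally show ?thesis .
    qed
    then have "(\<Sum>j<m. exp (\<tau> / M * h j)) \<le> (\<Sum>j<m. 1 + (\<tau> + \<tau>\<^sup>2) * (h j / M))"
      by (intro sum_mono) auto
    also have "\<dots> = real m + (\<tau> + \<tau>\<^sup>2) * (H / M)"
      by (simp add: sum.distrib H_def sum_divide_distrib sum_distrib_left)
    also have "\<dots> = real m * (1 + (\<tau> + \<tau>\<^sup>2) * H / (real m * M))"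
      using pos M by (simp add: field_simps)
    also have "\<dots> \<le> real m * r" unfolding r_def by (intro mult_left_mono exp_ge_add_one_self) auto
    finally show ?thesis .
  qed
  have "measure_pmf.prob (steps P \<epsilon> T orc T) {(Sx, Sy, n). accepts P \<epsilon> T Sx Sy}
      \<le> V 0 (\<lambda>_. 0) (\<lambda>_. 0)"
  proof (rule steps_prob_le[where V = V and bad = "accepts P \<epsilon> T"])
    show "0 < reqs P" using pos by (simp add: m_def)
    show "0 \<le> V s Sx Sy" for s Sx Sy by (simp add: V_def r_def)
    show "1 \<le> V T Sx Sy" if acc: "accepts P \<epsilon> T Sx Sy" for Sx Sy
    proof -
      have "real T / real m * D \<le> G Sx Sy"
        unfolding D_def G_def sum_distrib_left
      proof (rule sum_mono)
        fix i assume "i \<in> {..<n}"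
        then have i: "i < n" by simp
        have "Sx i < real T * cap P i / real m * (1 + \<epsilon>)" "real T * dem P i / real m * (1 - \<epsilon>) < Sy i"
          using acc i by (auto simp: accepts_def n_def m_def)
        then have "Sx i / cap P i \<le> real T / real m * (1 + \<epsilon>)" "real T / real m * (1 - \<epsilon>) \<le> Sy i / dem P i"
          using cd[OF i] by (simp_all add: pos_divide_le_eq pos_le_divide_eq mult_ac)
        then have "\<mu> i * (real T / real m * (1 - \<epsilon>)) - \<kappa> i * (real T / real m * (1 + \<epsilon>))
          \<le> \<mu> i * (Sy i / dem P i) - \<kappa> i * (Sx i / cap P i)"
          using \<kappa> \<mu> by (intro diff_mono mult_left_mono)
        then show "real T / real m * ((1 - \<epsilon>) * \<mu> i - (1 + \<epsilon>) * \<kappa> i)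
          \<le> \<mu> i * (Sy i / dem P i) - \<kappa> i * (Sx i / cap P i)"
          by (simp add: algebra_simps add_divide_distrib diff_divide_distrib)
      qed
      then have "\<tau> / M * (real T / real m * D) \<le> \<tau> / M * G Sx Sy"
        using \<tau> M by (intro mult_left_mono) auto
      then show ?thesis by (simp add: V_def)
    qed
    show "(\<Sum>j<reqs P. V (Suc s) (\<lambda>i. Sx i + load P (pack P) j (chosen P \<epsilon> T orc s Sx Sy j) i)
                            (\<lambda>i. Sy i + load P (cov P) j (chosen P \<epsilon> T orc s Sx Sy j) i))
      \<le> real (reqs P) * V s Sx Sy" if "s < T" for s Sx Sy
    proof -
      define w where "w = exp (\<tau> / M * G Sx Sy) * r ^ (T - s - 1) / exp (\<tau> / M * (real T / real m * D))"
      have w: "0 \<le> w" by (simp add: w_def r_def)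
      have "(\<Sum>j<m. V (Suc s) (\<lambda>i. Sx i + load P (pack P) j (chosen P \<epsilon> T orc s Sx Sy j) i)
                            (\<lambda>i. Sy i + load P (cov P) j (chosen P \<epsilon> T orc s Sx Sy j) i))
        \<le> (\<Sum>j<m. w * exp (\<tau> / M * h j))"
      proof (rule sum_mono)
        fix j assume "j \<in> {..<m}"
        then have j: "j < m" by simp
        define k where "k = orc j (\<lambda>k. - cost P \<epsilon> T Sx Sy s j k)"
        \<comment> \<open>\<open>h j\<close> caps the gain of every option, so the growth of
          \<open>G\<close> is bounded in terms of the draw alone, whatever the history.\<close>
        have k: "k \<in> opt" using orc j unfolding is_oracle_def k_def opt_def m_def by blast
        have "G (\<lambda>i. Sx i + load P (pack P) j (choice_vec k) i) (\<lambda>i. Sy i + load P (cov P) j (choice_vec k) i)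
          = G Sx Sy + (\<Sum>i<n. \<mu> i * W i j k - \<kappa> i * A i j k)"
          unfolding G_def A_def W_def sum.distrib[symmetric]
          by (intro sum.cong refl) (simp add: algebra_simps add_divide_distrib)
        also have "\<dots> \<le> G Sx Sy + h j" using best[OF j k] by simp
        finally have "\<tau> / M * G (\<lambda>i. Sx i + load P (pack P) j (choice_vec k) i)
            (\<lambda>i. Sy i + load P (cov P) j (choice_vec k) i) \<le> \<tau> / M * (G Sx Sy + h j)"
          using \<tau> M by (intro mult_left_mono) auto
        then have "exp (\<tau> / M * G (\<lambda>i. Sx i + load P (pack P) j (choice_vec k) i)
            (\<lambda>i. Sy i + load P (cov P) j (choice_vec k) i))
            \<le> exp (\<tau> / M * G Sx Sy) * exp (\<tau> / M * h j)"
          by (simp add: distrib_left flip: exp_add)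
        then have "V (Suc s) (\<lambda>i. Sx i + load P (pack P) j (choice_vec k) i)
            (\<lambda>i. Sy i + load P (cov P) j (choice_vec k) i)
          \<le> exp (\<tau> / M * G Sx Sy) * exp (\<tau> / M * h j) * r ^ (T - s - 1) / exp (\<tau> / M * (real T / real m * D))"
          unfolding V_def by (intro divide_right_mono) (auto intro!: mult_right_mono simp: r_def)
        then show "V (Suc s) (\<lambda>i. Sx i + load P (pack P) j (chosen P \<epsilon> T orc s Sx Sy j) i)
                            (\<lambda>i. Sy i + load P (cov P) j (chosen P \<epsilon> T orc s Sx Sy j) i)
            \<le> w * exp (\<tau> / M * h j)"
          by (simp add: chosen_def k_def w_def mult_ac)
      qed
      also have "\<dots> \<le> w * (real m * r)"
        using mgf w by (simp add: mult_left_mono flip: sum_distrib_left)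
      also have "\<dots> = real m * V s Sx Sy"
      proof -
        have "T - s = Suc (T - s - 1)" using that by simp
        then have "r ^ (T - s) = r * r ^ (T - s - 1)" by (metis power_Suc)
        then show ?thesis by (simp add: V_def w_def)
      qed
      finally show ?thesis by (simp add: m_def)
    qed
  qed
  also have "V 0 (\<lambda>_. 0) (\<lambda>_. 0) = exp (real T / (real m * M) * ((\<tau> + \<tau>\<^sup>2) * H - \<tau> * D))"
  proof -
    have "r ^ T = exp (real T * ((\<tau> + \<tau>\<^sup>2) * H / (real m * M)))"
      unfolding r_def by (rule exp_of_nat_mult[symmetric])
    then have "V 0 (\<lambda>_. 0) (\<lambda>_. 0)
      = exp (real T * ((\<tau> + \<tau>\<^sup>2) * H / (real m * M)) - \<tau> / M * (real T / real m * D))"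
      by (simp add: V_def G_def exp_diff)
    also have "real T * ((\<tau> + \<tau>\<^sup>2) * H / (real m * M)) - \<tau> / M * (real T / real m * D)
      = real T / (real m * M) * ((\<tau> + \<tau>\<^sup>2) * H - \<tau> * D)"
      using pos M by (simp add: field_simps)
    finally show ?thesis .
  qed
  also have "\<dots> \<le> exp (- ln (max 2 (real n / \<delta>)))"
  proof -
    \<comment> \<open>The gap gives \<open>D - H \<ge> \<epsilon> * Q\<close>, and with
      \<open>D \<le> Q\<close> also \<open>H \<le> Q\<close>. So the bracket is at most
      \<open>(\<tau>^2 - \<tau> * \<epsilon>) * Q = - (\<epsilon>^2 / 4 * Q)\<close>, and dividing
      by \<open>M = 2 * \<gamma> * Q\<close> produces the 8 of the sample size.\<close>
    have "(\<tau> + \<tau>\<^sup>2) * H - \<tau> * D = \<tau>\<^sup>2 * H - \<tau> * (D - H)" by (simp add: algebra_simps)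
    also have "\<dots> \<le> \<tau>\<^sup>2 * Q - \<tau> * (\<epsilon> * Q)"
    proof -
      have "0 \<le> \<epsilon> * Q" using eps Q by auto
      then have "H \<le> Q" "\<epsilon> * Q \<le> D - H" using gap D_le unfolding H_def D_def by linarith+
      then show ?thesis using \<tau> by (intro diff_mono mult_left_mono) auto
    qed
    also have "\<dots> = - (\<epsilon>\<^sup>2 / 4 * Q)" by (simp add: \<tau>_def power2_eq_square)
    finally have "real T / (real m * M) * ((\<tau> + \<tau>\<^sup>2) * H - \<tau> * D) \<le> real T / (real m * M) * (- (\<epsilon>\<^sup>2 / 4 * Q))"
      using M by (intro mult_left_mono) auto
    also have "\<dots> = - (\<epsilon>\<^sup>2 * real T * (1 / (real m * \<gamma>)) / 8)"
      using Q \<gamma> pos by (simp add: M_def field_simps)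
    also have "\<dots> \<le> - ln (max 2 (real n / \<delta>))"
    proof -
      have "- (b / 8) \<le> - a" if "8 * a \<le> b" for a b :: real using that by simp
      from this[OF num_samples_ge[of P \<epsilon> 8 \<delta>, folded m_def n_def \<gamma>_def T, OF pos(1) \<gamma> eps(1)]]
      show ?thesis .
    qed
    finally show ?thesis by simp
  qed
  also have "\<dots> \<le> \<delta>"
  proof -
    have "exp (- ln (max 2 (real n / \<delta>))) = 1 / max 2 (real n / \<delta>)"
      by (simp add: exp_minus inverse_eq_divide)
    also have "\<dots> \<le> 1 / (real n / \<delta>)"
      using pos \<delta> by (intro divide_left_mono) auto
    also have "\<dots> \<le> \<delta>" using pos \<delta> by (simp add: field_simps)
    finally show ?thesis .
  qed
  finally show ?thesis by (simp add: algorithm3_prob)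
qed

theorem theorem4:
  shows "\<exists>c>0. \<exists>C>0. \<forall>(\<epsilon>::real) (\<delta>::real) P orc T.
    0 < \<epsilon> \<longrightarrow> \<epsilon> < 1 \<longrightarrow> 0 < \<delta> \<longrightarrow> wf_mcp P \<longrightarrow> is_oracle P orc \<longrightarrow>
    gam P \<le> c * (\<epsilon>\<^sup>2 / ln (real (idxs P) / \<epsilon>)) \<longrightarrow>
    T = num_samples C P \<epsilon> \<delta> \<longrightarrow>
      (yes_instance P \<longrightarrow>
         measure_pmf.prob (algorithm3 P \<epsilon> T orc) {r. fst r = YES} \<ge> 1 - \<delta>) \<and>
      (no_instance \<epsilon> P \<longrightarrow>
         measure_pmf.prob (algorithm3 P \<epsilon> T orc) {r. fst r = NO} \<ge> 1 - \<delta>) \<and>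
      (\<forall>r\<in>set_pmf (algorithm3 P \<epsilon> T orc). snd r = T)"
\<comment> \<open>\<open>1 / 40\<close> is the constant of \<open>dual_certificate\<close>. The
  sample constant 8 serves both cases: it gives exponent \<open>2 * L\<close> at rate
  \<open>\<epsilon>^2 / 4\<close> for YES instances, and the single logarithm at rate
  \<open>\<epsilon>^2 / 8\<close> for NO instances.\<close>
proof (rule exI[of _ "1 / 40"], rule conjI, simp, rule exI[of _ 8], rule conjI, simp,
    intro allI impI conjI ballI)
  fix \<epsilon> \<delta> :: real and P orc T
  assume *: "0 < \<epsilon>" "\<epsilon> < 1" "0 < \<delta>" "wf_mcp P" "is_oracle P orc"
    "gam P \<le> 1 / 40 * (\<epsilon>\<^sup>2 / ln (real (idxs P) / \<epsilon>))" "T = num_samples 8 P \<epsilon> \<delta>"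
  show "1 - \<delta> \<le> measure_pmf.prob (algorithm3 P \<epsilon> T orc) {r. fst r = YES}" if "yes_instance P"
    using yes_instance_error[OF *(4,5) that *(1-3,7)] algorithm3_prob_compl[of P \<epsilon> T orc] by linarith
  show "1 - \<delta> \<le> measure_pmf.prob (algorithm3 P \<epsilon> T orc) {r. fst r = NO}" if "no_instance \<epsilon> P"
    using no_instance_error[OF *(4,5) that *(1-3,7,6)] algorithm3_prob_compl[of P \<epsilon> T orc] by linarith
  show "snd r = T" if "r \<in> set_pmf (algorithm3 P \<epsilon> T orc)" for r
    using algorithm3_calls[OF that] .
qed

end
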